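(* Let $\Phi$ be of type $A_2$ with simple roots $\alpha,\beta$, let $\widetilde W$ be the affine Weyl group of type $\widetilde A_2$, let $B=\{\alpha,\alpha+\beta,\beta\}^\wedge$, and let $\le_B$ be the (left) $B$-twisted strong Bruhat order on $\widetilde W$. Let $T$ be the translation subgroup of $\widetilde W$. (1) The sphericity of the intervals of $(\widetilde W,\le_B)$ is characterized as follows. (a) The length $2$ intervals of $(\widetilde W,\le_B)$ are either of the form $[x,s_1s_2x]$ where $s_1\ne s_2$, $s_1,s_2\in\{s_\alpha,s_\beta,s_{\delta-\alpha-\beta}\}$, or of the form $[x,s_{\delta-\gamma}s_\gamma x]$ where $\gamma\in\{\alpha,\beta,\alpha+\beta,\delta-\alpha,\delta-\beta,\delta-\alpha-\beta\}$. The former are spherical and the latter are non-spherical. (b) The length $3$ intervals of $(\widetilde W,\le_B)$ are all non-spherical except those of the following types: $[x,s_\alpha s_\beta s_\alpha x]$ where $x\in s_\alpha s_\beta s_\alpha T$; $[x,s_{\delta-\alpha-\beta}s_\beta s_{\delta-\alpha-\beta}x]$ where $x\in s_\beta T$; $[x,s_\alpha s_{\delta-\alpha-\beta}s_\alpha x]$ where $x\in s_\alpha T$. (c) All intervals of $(\widetilde W,\le_B)$ of length greater than $3$ are non-spherical. (2) Let $\mathbf x=(s_\beta s_{\delta-\alpha-\beta}s_\alpha)^\infty$ and $\mathbf y=(s_\alpha s_{\delta-\alpha-\beta}s_\beta)^\infty$ be two infinite reduced words. For $i\ge0$ denote by $w(i)$ and $w(-i)$ the unique length $i$ prefixes of $\mathbf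 x$ and $\mathbf y$ respectively. Let $U$ be the (infinite dihedral) reflection subgroup of $\widetilde W$ generated by $v:=s_{\delta-\alpha-\beta}$ and $u:=s_\alpha s_\beta s_\alpha$. For $x\in\widetilde W$ and $y$ in the left coset $xU$, $y$ is the unique minimal element of $xU$ if and only if $y=w(i)^{-1}$ for some $i\in\mathbb Z$. Consequently every element of $\widetilde W$ can be written in the form $w(i)^{-1}z$ for some $z\in U$ and $i\in\mathbb Z$. Furthermore, the twisted length $l_B$ is determined as follows, for $i\in\mathbb Z$ and $k\in\mathbb Z_{\ge0}$: (a) $l_B(w(i)^{-1}u(vu)^k)=-4k-3$ if $i$ is even and $l_B(w(i)^{-1}u(vu)^k)=-4k-2$ if $i$ is odd. (b) $l_B(w(i)^{-1}(vu)^k)=-4k$ if $i$ is even and $l_B(w(i)^{-1}(vu)^k)=-4k-1$ if $i$ is odd. (c) $l_B(w(i)^{-1}v(uv)^k)=4k+1$ if $i$ is even and $l_B(w(i)^{-1}v(uv)^k)=4k+2$ if $i$ is odd. (d) $l_B(w(i)^{-1}(uv)^k)=4k$ if $i$ is even and $l_B(w(i)^{-1}(uv)^k)=4k-1$ if $i$ is odd. (3) Suppose that $x,y\in\widetilde W$ are such that $l_B(x)$ and $l_B(y)$ are of the same parity. Then there exists a poset automorphism $\gamma:(\widetilde W,\le_B)\to(\widetilde W,\le_B)$ such that $\gamma(x)=y$.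
   Context: Affine root system: $\Phi=\{\pm\alpha,\pm\beta,\pm(\alpha+\beta)\}$ of type $A_2$ in the Euclidean plane $V$, $\Phi^+=\{\alpha,\beta,\alpha+\beta\}$, $\Phi^-=-\Phi^+$. Put $V'=V\oplus\mathbb R\delta$ with $(\delta,v)=0$ for all $v\in V'$. For $\gamma\in\Phi^+$ let $\{\gamma\}^\wedge=\{\gamma+n\delta\mid n\in\mathbb Z_{\ge0}\}$; for $\gamma\in\Phi^-$ let $\{\gamma\}^\wedge=\{\gamma+(n+1)\delta\mid n\in\mathbb Z_{\ge0}\}$; for $\Lambda\subset\Phi$ let $\Lambda^\wedge=\bigcup_{\gamma\in\Lambda}\{\gamma\}^\wedge$. Positive roots: $\widetilde\Phi^+=\Phi^\wedge$; all roots: $\widetilde\Phi=\Phi^\wedge\uplus-\Phi^\wedge$. $\widetilde W$ is generated by the reflections $s_\gamma(v)=v-2\frac{(v,\gamma)}{(\gamma,\gamma)}\gamma$, $\gamma\in\widetilde\Phi$; it is a Coxeter group with simple reflections $s_\alpha,s_\beta,s_{\delta-\alpha-\beta}$ and length function $l$. For $v\in V$ let $t_v(x)=x+(x,v)\delta$ on $V'$, and $\gamma^\vee=2\gamma/(\gamma,\gamma)$; $T$ is the free abelian group generated by $t_{\alpha^\vee},t_{\beta^\vee}$, and $\widetilde W=W\ltimes T$ with $W=\langle s_\alpha,s_\beta\rangle$. $N(w)=\{\gamma\in\widetilde\Phi^+\mid w^{-1}(\gamma)\in-\widetilde\Phi^+\}$. Twisted length: $l_B(w)=l(w)-2|N(w^{-1})\cap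 B|$. Twisted strong Bruhat order: $x\le_B y$ iff $y=t_k\cdots t_1x$ for some $k\ge0$ and reflections $t_i$ of $\widetilde W$ with $l_B(t_i\cdots t_1x)=l_B(t_{i-1}\cdots t_1x)+1$ for $1\le i\le k$. This poset is graded by $l_B$; the length of an interval $[x,y]$ is $l_B(y)-l_B(x)$. A closed interval is spherical if every length $2$ subinterval of it contains exactly $4$ elements. An infinite reduced word is an infinite sequence $s_1s_2\cdots$ of simple reflections all of whose initial segments are reduced; its inversion set is $N(s_1s_2\cdots)=\bigcup_iN(s_1\cdots s_i)$. Here $(s_1s_2s_3)^\infty$ denotes the infinite periodic word $s_1s_2s_3s_1s_2s_3\cdots$. A prefix of an infinite reduced word $\mathbf w$ is an element $p\in\widetilde W$ with $N(p)\subset N(\mathbf w)$. The minimal element of a left coset $xU$ is its element of minimal ordinary length $l$. *)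

theory Defs
  imports "HOL-Analysis.Euclidean_Space" "HOL-Analysis.Product_Vector"
    "HOL-Algebra.Bij" "HOL-Algebra.Generated_Groups"
begin

unbundle inner_syntax

text \<open>
  The space \<open>V' = V \<oplus> \<real>\<delta>\<close> is \<open>'a \<times> real\<close>, where \<open>'a\<close> is the Euclidean space \<open>V\<close>, embedded by
  \<open>v \<mapsto> (v, 0)\<close>, and \<open>\<delta> = (0, 1)\<close>. The form on \<open>V'\<close> is the degenerate extension of the inner
  product of \<open>V\<close> with \<open>\<delta>\<close> in its radical; it is not the inner product of the product type.
  Group elements are functions \<open>V' \<Rightarrow> V'\<close>, multiplied by composition, and subgroups generated by
  bijections are taken in the group \<open>BijGroup UNIV\<close> of all bijections of \<open>V'\<close>.
\<close>

definition aff_form :: "'a::real_inner \<times> real \<Rightarrow> 'a \<times> real \<Rightarrow> real" where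
  "aff_form x y = fst x \<bullet> fst y"

definition \<delta> :: "'a::real_inner \<times> real" where
  "\<delta> = (0, 1)"

definition aff_reflection :: "'a::real_inner \<times> real \<Rightarrow> 'a \<times> real \<Rightarrow> 'a \<times> real" where
  "aff_reflection \<gamma> v = v - (2 * aff_form v \<gamma> / aff_form \<gamma> \<gamma>) *\<^sub>R \<gamma>"

definition transl :: "'a::real_inner \<Rightarrow> 'a \<times> real \<Rightarrow> 'a \<times> real" where
  "transl v x = x + aff_form x (v, 0) *\<^sub>R \<delta>"

definition coroot :: "'a::real_inner \<Rightarrow> 'a" where
  "coroot \<gamma> = (2 / (\<gamma> \<bullet> \<gamma>)) *\<^sub>R \<gamma>"

text \<open>Both Cartan integers are \<open>-1\<close>; as \<open>x / 0 = 0\<close>, this forces \<open>\<alpha>\<close> and \<open>\<beta>\<close> to be nonzero.\<close>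

definition A2_simple_roots :: "'a::real_inner \<Rightarrow> 'a \<Rightarrow> bool" where
  "A2_simple_roots \<alpha> \<beta> \<longleftrightarrow> 2 * (\<alpha> \<bullet> \<beta>) / (\<alpha> \<bullet> \<alpha>) = -1 \<and> 2 * (\<alpha> \<bullet> \<beta>) / (\<beta> \<bullet> \<beta>) = -1"

definition word_prod :: "('v \<Rightarrow> 'v) list \<Rightarrow> 'v \<Rightarrow> 'v" where
  "word_prod ss = foldr (\<circ>) ss id"

definition initial_prod :: "(nat \<Rightarrow> 'v \<Rightarrow> 'v) \<Rightarrow> nat \<Rightarrow> 'v \<Rightarrow> 'v" where
  "initial_prod \<omega> n = word_prod (map \<omega> [0..<n])"

definition periodic_word :: "'s list \<Rightarrow> nat \<Rightarrow> 's" where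
  "periodic_word ss n = ss ! (n mod length ss)"

context
  fixes \<alpha> \<beta> :: "'a::real_inner"
begin

definition Phi_pos :: "'a set" where
  "Phi_pos = {\<alpha>, \<beta>, \<alpha> + \<beta>}"

definition Phi_neg :: "'a set" where
  "Phi_neg = uminus ` Phi_pos"

definition Phi :: "'a set" where
  "Phi = Phi_pos \<union> Phi_neg"

text \<open>Only meant for subsets \<open>\<Lambda>\<close> of \<open>Phi\<close>.\<close>

definition aff_hat :: "'a set \<Rightarrow> ('a \<times> real) set" where
  "aff_hat \<Lambda> = {(\<gamma>, 0) + real n *\<^sub>R \<delta> |\<gamma> n. \<gamma> \<in> \<Lambda> \<inter> Phi_pos}
         \<union> {(\<gamma>, 0) + (real n + 1) *\<^sub>R \<delta> |\<gamma> n. \<gamma> \<in> \<Lambda> \<inter> Phi_neg}"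

definition aff_pos_roots :: "('a \<times> real) set" where
  "aff_pos_roots = aff_hat Phi"

definition aff_roots :: "('a \<times> real) set" where
  "aff_roots = aff_hat Phi \<union> uminus ` aff_hat Phi"

definition aff_Weyl :: "('a \<times> real \<Rightarrow> 'a \<times> real) set" where
  "aff_Weyl = generate (BijGroup UNIV) (aff_reflection ` aff_roots)"

definition transl_group :: "('a \<times> real \<Rightarrow> 'a \<times> real) set" where
  "transl_group = generate (BijGroup UNIV) {transl (coroot \<alpha>), transl (coroot \<beta>)}"

definition simple_refls :: "('a \<times> real \<Rightarrow> 'a \<times> real) set" where
  "simple_refls = {aff_reflection (\<alpha>, 0), aff_reflection (\<beta>, 0), aff_reflection (\<delta> - (\<alpha>, 0) - (\<beta>, 0))}"

definition cox_len :: "('a \<times> real \<Rightarrow> 'a \<times> real) \<Rightarrow> nat" where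
  "cox_len w = (LEAST n. \<exists>ss. set ss \<subseteq> simple_refls \<and> length ss = n \<and> word_prod ss = w)"

definition inv_set :: "('a \<times> real \<Rightarrow> 'a \<times> real) \<Rightarrow> ('a \<times> real) set" where
  "inv_set w = {\<gamma> \<in> aff_pos_roots. inv_into UNIV w \<gamma> \<in> uminus ` aff_pos_roots}"

definition tw_len :: "('a \<times> real) set \<Rightarrow> ('a \<times> real \<Rightarrow> 'a \<times> real) \<Rightarrow> int" where
  "tw_len B w = int (cox_len w) - 2 * int (card (inv_set (inv_into UNIV w) \<inter> B))"

definition tw_le ::
  "('a \<times> real) set \<Rightarrow> ('a \<times> real \<Rightarrow> 'a \<times> real) \<Rightarrow> ('a \<times> real \<Rightarrow> 'a \<times> real) \<Rightarrow> bool" where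
  "tw_le B = (\<lambda>x y. \<exists>\<gamma>\<in>aff_roots. y = aff_reflection \<gamma> \<circ> x \<and> tw_len B y = tw_len B x + 1)\<^sup>*\<^sup>*"

definition tw_interval :: "('a \<times> real) set \<Rightarrow> ('a \<times> real \<Rightarrow> 'a \<times> real) \<Rightarrow>
    ('a \<times> real \<Rightarrow> 'a \<times> real) \<Rightarrow> ('a \<times> real \<Rightarrow> 'a \<times> real) set" where
  "tw_interval B x y = {z \<in> aff_Weyl. tw_le B x z \<and> tw_le B z y}"

definition is_tw_interval :: "('a \<times> real) set \<Rightarrow> int \<Rightarrow> ('a \<times> real \<Rightarrow> 'a \<times> real) \<Rightarrow>
    ('a \<times> real \<Rightarrow> 'a \<times> real) \<Rightarrow> bool" where
  "is_tw_interval B n x y \<longleftrightarrow>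
     x \<in> aff_Weyl \<and> y \<in> aff_Weyl \<and> tw_le B x y \<and> tw_len B y - tw_len B x = n"

definition spherical :: "('a \<times> real) set \<Rightarrow> ('a \<times> real \<Rightarrow> 'a \<times> real) \<Rightarrow>
    ('a \<times> real \<Rightarrow> 'a \<times> real) \<Rightarrow> bool" where
  "spherical B x y \<longleftrightarrow> (\<forall>a\<in>tw_interval B x y. \<forall>b\<in>tw_interval B x y.
     is_tw_interval B 2 a b \<longrightarrow> card (tw_interval B a b) = 4)"

definition inf_reduced :: "(nat \<Rightarrow> 'a \<times> real \<Rightarrow> 'a \<times> real) \<Rightarrow> bool" where
  "inf_reduced \<omega> \<longleftrightarrow> range \<omega> \<subseteq> simple_refls \<and> (\<forall>n. cox_len (initial_prod \<omega> n) = n)"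

definition is_prefix ::
  "('a \<times> real \<Rightarrow> 'a \<times> real) \<Rightarrow> (nat \<Rightarrow> 'a \<times> real \<Rightarrow> 'a \<times> real) \<Rightarrow> bool" where
  "is_prefix p \<omega> \<longleftrightarrow> p \<in> aff_Weyl \<and> inv_set p \<subseteq> (\<Union>n. inv_set (initial_prod \<omega> n))"

definition the_prefix :: "(nat \<Rightarrow> 'a \<times> real \<Rightarrow> 'a \<times> real) \<Rightarrow> nat \<Rightarrow> 'a \<times> real \<Rightarrow> 'a \<times> real" where
  "the_prefix \<omega> n = (THE p. is_prefix p \<omega> \<and> cox_len p = n)"

definition unique_minimal ::
  "('a \<times> real \<Rightarrow> 'a \<times> real) \<Rightarrow> ('a \<times> real \<Rightarrow> 'a \<times> real) set \<Rightarrow> bool" where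
  "unique_minimal y C \<longleftrightarrow> y \<in> C \<and> (\<forall>z\<in>C. z \<noteq> y \<longrightarrow> cox_len y < cox_len z)"

end

end

theory Submission
  imports Defs
begin

text \<open>
  Write an element of the affine Weyl group as \<open>w t\<close> with \<open>w\<close> in the finite Weyl group and \<open>t\<close> a translation,
  and for a positive root \<open>\<gamma>\<close> let \<open>k(\<gamma>)\<close> be the signed number of hyperplanes orthogonal to \<open>\<gamma>\<close>
  that separate the corresponding alcove from the fundamental one (the Shi coordinates). The ordinary
  length is the sum of the \<open>\<bar>k(\<gamma>)\<bar>\<close>, and the twisted length is the sum \<open>c\<close> of the \<open>k(\<gamma>)\<close>.
  The number \<open>i = k(\<alpha>) - k(\<beta>)\<close> is constant exactly on the cosets \<open>x U\<close>, and an element is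
  determined by the pair \<open>(i, c)\<close>, where all pairs with \<open>i + c div 2\<close> even occur.
  In these coordinates a covering relation raises \<open>c\<close> by one and moves \<open>i\<close> by \<open>0\<close> or \<open>\<plusminus>2\<close> if
  \<open>c\<close> is even, and by \<open>\<plusminus>1\<close> if \<open>c\<close> is odd. Hence the twisted Bruhat order is a light-cone order
  on a planar lattice: \<open>(i, c) \<le> (i', c')\<close> iff \<open>\<bar>i' - i\<bar> \<le> r(c') - r(c)\<close> with
  \<open>r(c) = \<lfloor>(3 c + 1) / 2\<rfloor>\<close>. All claims about intervals and automorphisms become planar geometry.
\<close>

section \<open>A combinatorial model of the affine Weyl group\<close>

text \<open>\<open>(w, a, b)\<close> stands for \<open>w\<close> times the translation by \<open>a \<alpha>\<^sup>\<or> + b \<beta>\<^sup>\<or>\<close>;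
  \<open>W_ab\<close> stands for \<open>s\<^sub>\<alpha> s\<^sub>\<beta>\<close> and so on.\<close>

datatype weyl = W_1 | W_a | W_b | W_ab | W_ba | W_aba

fun left_a :: "weyl \<Rightarrow> weyl" where
  "left_a W_1 = W_a" | "left_a W_a = W_1" | "left_a W_b = W_ab"
| "left_a W_ab = W_b" | "left_a W_ba = W_aba" | "left_a W_aba = W_ba"

fun left_b :: "weyl \<Rightarrow> weyl" where
  "left_b W_1 = W_b" | "left_b W_b = W_1" | "left_b W_a = W_ba"
| "left_b W_ba = W_a" | "left_b W_ab = W_aba" | "left_b W_aba = W_ab"

fun weyl_mult :: "weyl \<Rightarrow> weyl \<Rightarrow> weyl" where
  "weyl_mult W_1 w = w" | "weyl_mult W_a w = left_a w" | "weyl_mult W_b w = left_b w"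
| "weyl_mult W_ab w = left_a (left_b w)" | "weyl_mult W_ba w = left_b (left_a w)"
| "weyl_mult W_aba w = left_a (left_b (left_a w))"

fun weyl_inv :: "weyl \<Rightarrow> weyl" where
  "weyl_inv W_ab = W_ba" | "weyl_inv W_ba = W_ab" | "weyl_inv W_1 = W_1"
| "weyl_inv W_a = W_a" | "weyl_inv W_b = W_b" | "weyl_inv W_aba = W_aba"

text \<open>The action of \<open>w\<^sup>-\<^sup>1\<close> on the coroot lattice.\<close>

fun coroot_pull :: "weyl \<Rightarrow> int \<times> int \<Rightarrow> int \<times> int" where
  "coroot_pull W_1 (a, b) = (a, b)"
| "coroot_pull W_a (a, b) = (b - a, b)"
| "coroot_pull W_b (a, b) = (a, a - b)"
| "coroot_pull W_ab (a, b) = (b - a, - a)"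
| "coroot_pull W_ba (a, b) = (- b, a - b)"
| "coroot_pull W_aba (a, b) = (- b, - a)"

type_synonym awg = "weyl \<times> int \<times> int"

text \<open>Moving the translation by \<mu> to the right past \<open>w'\<close> turns it into the
  translation by w'^-1 \<mu>, which is \<open>coroot_pull w' \<mu>\<close>.\<close>

fun awg_mult :: "awg \<Rightarrow> awg \<Rightarrow> awg" where
  "awg_mult (w, \<mu>) (w', \<nu>) = (weyl_mult w w', coroot_pull w' \<mu> + \<nu>)"

fun awg_inv :: "awg \<Rightarrow> awg" where
  "awg_inv (w, \<mu>) = (weyl_inv w, coroot_pull (weyl_inv w) (- \<mu>))"

lemma awg_mult_inv: "awg_mult m (awg_inv m) = (W_1, 0, 0)" "awg_mult (awg_inv m) m = (W_1, 0, 0)"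
proof -
  obtain w a b where m: "m = (w, a, b)" by (cases m)
  show "awg_mult m (awg_inv m) = (W_1, 0, 0)" "awg_mult (awg_inv m) m = (W_1, 0, 0)"
    unfolding m by (cases w; simp add: zero_prod_def)+
qed

text \<open>Indicators of \<open>w \<gamma> < 0\<close> for \<open>\<gamma> = \<alpha>, \<beta>, \<alpha> + \<beta>\<close>.\<close>

fun neg_a :: "weyl \<Rightarrow> int" where
  "neg_a W_1 = 0" | "neg_a W_a = 1" | "neg_a W_b = 0"
| "neg_a W_ab = 0" | "neg_a W_ba = 1" | "neg_a W_aba = 1"

fun neg_b :: "weyl \<Rightarrow> int" where
  "neg_b W_1 = 0" | "neg_b W_a = 0" | "neg_b W_b = 1"
| "neg_b W_ab = 1" | "neg_b W_ba = 0" | "neg_b W_aba = 1"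

fun neg_t :: "weyl \<Rightarrow> int" where
  "neg_t W_1 = 0" | "neg_t W_a = 0" | "neg_t W_b = 0"
| "neg_t W_ab = 1" | "neg_t W_ba = 1" | "neg_t W_aba = 1"

text \<open>The pairing of the translation part with the root, lowered by one when \<open>w\<close>
  makes the root negative; \<open>awg_map_negative_iff\<close> shows that these are the Shi
  coordinates.\<close>

fun shi_a :: "awg \<Rightarrow> int" where "shi_a (w, a, b) = 2 * a - b - neg_a w"
fun shi_b :: "awg \<Rightarrow> int" where "shi_b (w, a, b) = 2 * b - a - neg_b w"
fun shi_t :: "awg \<Rightarrow> int" where "shi_t (w, a, b) = a + b - neg_t w"

definition column :: "awg \<Rightarrow> int" where "column m = shi_a m - shi_b m"
definition level :: "awg \<Rightarrow> int" where "level m = shi_a m + shi_b m + shi_t m"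
definition shi_len :: "awg \<Rightarrow> int" where "shi_len m = \<bar>shi_a m\<bar> + \<bar>shi_b m\<bar> + \<bar>shi_t m\<bar>"

text \<open>The pairings add up, so only the corrections matter: if \<open>w\<close> makes \<alpha>
  and \<beta> both negative or both positive, then the same holds for their sum; in the mixed case
  either sign fits the bounds.\<close>

lemma shi_t_bounds: "shi_a m + shi_b m \<le> shi_t m" "shi_t m \<le> shi_a m + shi_b m + 1"
proof -
  obtain w a b where m: "m = (w, a, b)" by (cases m)
  show "shi_a m + shi_b m \<le> shi_t m" "shi_t m \<le> shi_a m + shi_b m + 1"
    unfolding m by (cases w; simp)+
qed

text \<open>By the bounds the level is twice k(\<alpha>) + k(\<beta>) or one more, and a sum has the
  parity of the difference.\<close>

lemma even_column: "even (column m + level m div 2)"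
proof -
  have "level m div 2 = shi_a m + shi_b m"
    using shi_t_bounds[of m] unfolding level_def by presburger
  then show ?thesis unfolding column_def by presburger
qed

text \<open>The column modulo 3 and the parity of the level separate the six finite parts; once
  \<open>w\<close> is known, the two equations fix a - b and a + b.\<close>

lemma column_level_inject:
  assumes "column m = column m'" "level m = level m'"
  shows "m = m'"
proof -
  obtain w a b where m: "m = (w, a, b)" by (cases m)
  obtain w' a' b' where m': "m' = (w', a', b')" by (cases m')
  have 1: "3 * (a - b) + (neg_b w - neg_a w) = 3 * (a' - b') + (neg_b w' - neg_a w')"
    using assms(1) unfolding m m' column_def by simp
  have 2: "2 * (a + b) - (neg_a w + neg_b w + neg_t w) = 2 * (a' + b') - (neg_a w' + neg_b w' + neg_t w')"
    using assms(2) unfolding m m' level_def by simp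
  have "(neg_b w - neg_a w) mod 3 = (neg_b w' - neg_a w') mod 3"
    using 1 by presburger
  moreover have "even (neg_a w + neg_b w + neg_t w) = even (neg_a w' + neg_b w' + neg_t w')"
    using 2 by presburger
  ultimately have "w = w'" by (cases w; cases w'; simp)
  then show ?thesis using 1 2 unfolding m m' by simp
qed

text \<open>The residues of \<open>i\<close> and \<open>c\<close> choose \<open>w\<close>; then a +
  b = \<open>s\<close> and a - b = \<open>t\<close> need equal parity, which is what the hypothesis
  provides.\<close>

lemma column_level_surj:
  assumes "even (i + c div 2)"
  obtains m where "column m = i" "level m = c"
proof -
  define f where "f w = neg_b w - neg_a w" for w
  define l where "l w = neg_a w + neg_b w + neg_t w" for w
  obtain w where w: "i mod 3 = f w mod 3" "even (c + l w)"
  proof -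
    have "i mod 3 = 0 \<or> i mod 3 = 1 \<or> i mod 3 = 2" by presburger
    then consider "even c" "i mod 3 = 0" | "even c" "i mod 3 = 1" | "even c" "i mod 3 = 2"
      | "odd c" "i mod 3 = 0" | "odd c" "i mod 3 = 1" | "odd c" "i mod 3 = 2"
      by blast
    then show thesis
    proof cases
      case 1 then show thesis by (intro that[of W_1]) (auto simp: f_def l_def)
    next
      case 2 then show thesis by (intro that[of W_ab]) (auto simp: f_def l_def)
    next
      case 3 then show thesis by (intro that[of W_ba]) (auto simp: f_def l_def)
    next
      case 4 then show thesis by (intro that[of W_aba]) (auto simp: f_def l_def)
    next
      case 5 then show thesis by (intro that[of W_b]) (auto simp: f_def l_def)
    next
      case 6 then show thesis by (intro that[of W_a]) (auto simp: f_def l_def)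
    qed
  qed
  obtain t where t: "i = 3 * t + f w"
    using w(1) by (metis add.commute diff_add_cancel dvd_def mod_eq_dvd_iff)
  obtain s where s: "c = 2 * s - l w"
    using w(2) by (metis add_diff_cancel_right' dvd_def)
  have "even (s + t)"
    using assms unfolding t s f_def l_def by (cases w; simp; presburger)
  then have "2 * ((s + t) div 2) = s + t" "2 * ((s - t) div 2) = s - t" by simp_all
  then have "column (w, (s + t) div 2, (s - t) div 2) = i" "level (w, (s + t) div 2, (s - t) div 2) = c"
    unfolding t s f_def l_def column_def level_def by simp_all
  then show thesis by (rule that)
qed

section \<open>The light-cone order and its generation by reflections\<close>

definition cone_width :: "int \<Rightarrow> int" where "cone_width c = (3 * c + 1) div 2"

definition cone_le :: "awg \<Rightarrow> awg \<Rightarrow> bool" where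
  "cone_le m m' \<longleftrightarrow> \<bar>column m' - column m\<bar> \<le> cone_width (level m') - cone_width (level m)"

text \<open>With \<open>n\<close> ranging over the integers, these are the reflections in \<open>\<gamma> - n \<delta>\<close>.\<close>

definition refl_model :: "awg set" where
  "refl_model = (\<Union>n. {(W_a, n, 0), (W_b, 0, n), (W_aba, n, n)})"

lemma cone_le_trans: "cone_le m m' \<Longrightarrow> cone_le m' m'' \<Longrightarrow> cone_le m m''"
  unfolding cone_le_def by linarith

lemma cone_le_level: "cone_le m m' \<Longrightarrow> level m \<le> level m'"
  unfolding cone_le_def cone_width_def by presburger

lemma cone_le_antisym: "cone_le m m' \<Longrightarrow> level m' \<le> level m \<Longrightarrow> m = m'"
  using cone_le_level[of m m'] by (intro column_level_inject) (auto simp: cone_le_def)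

text \<open>The increments are the largest column moves of a covering step out of an even and out of
  an odd level.\<close>

lemma cone_width_Suc: "cone_width (c + 1) = cone_width c + (if even c then 2 else 1)"
  unfolding cone_width_def by simp presburger

lemma cone_width_add_2: "cone_width (c + 2) = cone_width c + 3"
  unfolding cone_width_def by simp

lemma cone_le_refl [simp]: "cone_le m m"
  unfolding cone_le_def by simp

text \<open>For each \<open>w\<close> and each family of reflections the level change is linear in
  the index n with nonzero slope, so rising by one leaves at most one n, for which the column move
  is checked.\<close>

lemma refl_model_step:
  assumes "r \<in> refl_model" "level (awg_mult r m) = level m + 1"
  shows "cone_le m (awg_mult r m)"
proof -
  obtain w a b where m: "m = (w, a, b)" by (cases m)
  obtain n where "r = (W_a, n, 0) \<or> r = (W_b, 0, n) \<or> r = (W_aba, n, n)"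
    using assms(1) unfolding refl_model_def by blast
  then have "\<bar>column (awg_mult r m) - column m\<bar> \<le> (if even (level m) then 2 else 1)"
    using assms(2) unfolding m column_def level_def
    by (elim disjE; cases w; simp)
  then show ?thesis unfolding cone_le_def assms(2) cone_width_Suc by simp
qed

lemma refl_model_step_exists:
  assumes "cone_le m m'" "level m' = level m + 1"
  obtains r where "r \<in> refl_model" "m' = awg_mult r m"
proof -
  obtain w a b where m: "m = (w, a, b)" by (cases m)
  define d where "d = column m' - column m"
  have "even (column m + level m div 2)" "even (column m' + (level m + 1) div 2)"
    using even_column[of m] even_column[of m'] assms(2) by simp_all
  then have "even d \<longleftrightarrow> even (level m)" unfolding d_def by presburger
  moreover have "\<bar>d\<bar> \<le> (if even (level m) then 2 else 1)"
    using assms unfolding cone_le_def assms(2) cone_width_Suc d_def by simp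
  ultimately have d: "if even (level m) then d = - 2 \<or> d = 0 \<or> d = 2 else d = - 1 \<or> d = 1"
    by (cases "even (level m)"; simp; presburger)
  \<comment> \<open>Parity and cone width leave two or three values of \<open>d\<close>; the indices
    -1, 0, 1 already contain a reflection realising each of them.\<close>
  have "\<exists>n\<in>{- 1, 0, 1}. \<exists>r\<in>{(W_a, n, 0), (W_b, 0, n), (W_aba, n, n)}.
      column (awg_mult r m) = column m + d \<and> level (awg_mult r m) = level m + 1"
    using d unfolding m column_def level_def by (cases w; simp; elim disjE; simp)
  then obtain n r where r: "r \<in> {(W_a, n, 0), (W_b, 0, n), (W_aba, n, n)}"
    "column (awg_mult r m) = column m + d" "level (awg_mult r m) = level m + 1" by blast
  then have "r \<in> refl_model" "m' = awg_mult r m"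
    using assms(2) unfolding refl_model_def d_def by (blast, intro column_level_inject) simp_all
  then show thesis by (rule that)
qed

definition awg_step :: "awg \<Rightarrow> awg \<Rightarrow> bool" where
  "awg_step m m' \<longleftrightarrow> (\<exists>r\<in>refl_model. m' = awg_mult r m) \<and> level m' = level m + 1"

lemma awg_step_iff: "awg_step m m' \<longleftrightarrow> cone_le m m' \<and> level m' = level m + 1"
  unfolding awg_step_def using refl_model_step refl_model_step_exists by metis

text \<open>Peels off the top step of a chain, so that induction on the level difference reduces the
  cone order to covering steps.\<close>

lemma cone_le_predecessor:
  assumes "cone_le m m'" "m \<noteq> m'"
  obtains k where "cone_le m k" "cone_le k m'" "level m' = level k + 1"
proof -
  define c where "c = level m' - 1"
  define d where "d = column m' - column m"
  have c: "level m' = c + 1" unfolding c_def by simp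
  have mc: "level m \<le> c"
    using cone_le_antisym[OF assms(1)] assms(2) unfolding c_def by force
  have cone: "\<bar>d\<bar> \<le> cone_width (c + 1) - cone_width (level m)"
    using assms(1) unfolding cone_le_def d_def c .
  have even_m: "even (column m + level m div 2)" and even_m': "even (column m' + (c + 1) div 2)"
    using even_column[of m] even_column[of m'] c by simp_all
  show thesis
  proof (cases "level m = c")
    case True
    show thesis using assms(1) True c by (intro that[of m]) (auto simp: cone_le_def)
  next
    case False
    \<comment> \<open>One unit of slack absorbs the case where \<open>d\<close> lies midway between
      two admissible last moves, so that rounding costs 1.\<close>
    then have slack: "cone_width c - cone_width (level m) \<ge> 1"
      using mc unfolding cone_width_def by presburger
    \<comment> \<open>The column move of the last step: a move admissible for the parity of
      \<open>c\<close> that is nearest to \<open>d\<close>.\<close>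
    define e :: int where "e = (if even c then (if d \<ge> 2 then 2 else if d \<le> - 2 then - 2 else 0) else if d > 0 then 1 else - 1)"
    have "even e \<longleftrightarrow> even c" unfolding e_def by simp
    then have "even (column m' - e + c div 2)"
      using even_m' by presburger
    then obtain k where k: "column k = column m' - e" "level k = c"
      using column_level_surj by blast
    have "\<bar>d - e\<bar> \<le> cone_width c - cone_width (level m)"
      using cone slack unfolding e_def cone_width_Suc by (auto split: if_splits)
    then have "cone_le m k"
      unfolding cone_le_def k d_def by (simp add: algebra_simps)
    moreover have "cone_le k m'"
      unfolding cone_le_def k c cone_width_Suc e_def by simp
    ultimately show thesis using that k c by blast
  qed
qed

lemma rtranclp_awg_step_iff: "awg_step\<^sup>*\<^sup>* m m' \<longleftrightarrow> cone_le m m'"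
proof
  assume "awg_step\<^sup>*\<^sup>* m m'"
  then show "cone_le m m'"
    by induction (auto simp: awg_step_iff intro: cone_le_trans)
next
  assume "cone_le m m'"
  then show "awg_step\<^sup>*\<^sup>* m m'"
  proof (induction "nat (level m' - level m)" arbitrary: m' rule: less_induct)
    case less
    show ?case
    proof (cases "m = m'")
      case False
      then obtain k where k: "cone_le m k" "cone_le k m'" "level m' = level k + 1"
        using cone_le_predecessor less.prems by blast
      then have "awg_step\<^sup>*\<^sup>* m k"
        using less.hyps[of k] cone_le_level[OF k(1)] by simp
      moreover have "awg_step k m'"
        using k by (simp add: awg_step_iff)
      ultimately show ?thesis by simp
    qed simp
  qed
qed

section \<open>Intervals, sphericity and automorphisms of the light-cone order\<close>

definition cone_interval :: "awg \<Rightarrow> awg \<Rightarrow> awg set" where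
  "cone_interval m m' = {k. cone_le m k \<and> cone_le k m'}"

text \<open>Parity and the total width 3 leave displacement 1 or 3. The middle level holds two
  elements in the first case and one in the second; the two ends complete the count.\<close>

lemma cone_interval_length_2:
  assumes "cone_le m m'" "level m' = level m + 2"
  obtains "\<bar>column m' - column m\<bar> = 1" "card (cone_interval m m') = 4"
    | "\<bar>column m' - column m\<bar> = 3" "card (cone_interval m m') = 3"
proof -
  define c i i' where "c = level m" and "i = column m" and "i' = column m'"
  have width: "cone_width (c + 2) = cone_width c + 3" "cone_width (c + 1) = cone_width c + (if even c then 2 else 1)"
    by (simp_all add: cone_width_Suc cone_width_add_2)
  have ev: "even (i + c div 2)" "even (i' + (c + 2) div 2)"
    using even_column[of m] even_column[of m'] assms(2) unfolding c_def i_def i'_def by simp_all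
  have "\<bar>i' - i\<bar> \<le> 3"
    using assms(1) unfolding cone_le_def assms(2) width[unfolded c_def] i_def i'_def by simp
  moreover have "odd (i' - i)" using ev by presburger
  ultimately have d: "i' = i + 1 \<or> i' = i - 1 \<or> i' = i + 3 \<or> i' = i - 3" by presburger
  define M where "M = {k. level k = c + 1 \<and> cone_le m k \<and> cone_le k m'}"
  \<comment> \<open>The columns one step above \<open>m\<close> that are also one step below
    \<open>m'\<close>; the parity of \<open>c\<close> decides which of the two steps is the wide
    one.\<close>
  define J where "J = (if even c then {i' - 1, i' + 1} \<inter> {i - 2, i, i + 2} else {i - 1, i + 1} \<inter> {i' - 2, i', i' + 2})"
  have "column ` M = J"
  proof (intro equalityI subsetI)
    fix j assume "j \<in> column ` M"
    then obtain k where k: "j = column k" "level k = c + 1" "cone_le m k" "cone_le k m'"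
      unfolding M_def by blast
    have "even (j + (c + 1) div 2)"
      using even_column[of k] k by simp
    then have par: "even (j - i) \<longleftrightarrow> even c" "even (i' - j) \<longleftrightarrow> odd c"
      using ev by presburger+
    have "\<bar>j - i\<bar> \<le> (if even c then 2 else 1)" "\<bar>i' - j\<bar> \<le> (if even c then 1 else 2)"
      using k(3,4) width assms(2)[folded c_def] unfolding cone_le_def k(1,2) i_def i'_def c_def[symmetric]
      by (auto split: if_splits)
    with par show "j \<in> J" unfolding J_def
      by (cases "even c"; simp; presburger)
  next
    fix j assume j: "j \<in> J"
    then have "even (j + (c + 1) div 2)"
      using ev unfolding J_def by (auto split: if_splits; presburger)
    then obtain k where k: "column k = j" "level k = c + 1"
      using column_level_surj by blast
    have "cone_le m k" "cone_le k m'"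
      using j width assms(2)[folded c_def] k(2) unfolding cone_le_def k i_def[symmetric] i'_def[symmetric] c_def[symmetric]
      by (auto simp: J_def split: if_splits)
    then show "j \<in> column ` M"
      unfolding M_def using k by blast
  qed
  moreover have "inj_on column M"
    unfolding M_def by (intro inj_onI, elim CollectE conjE) (simp add: column_level_inject)
  ultimately have M: "card M = card J" and "finite M"
    using card_image[of column M] finite_image_iff[of column M] by (auto simp: J_def split: if_splits)
  have "cone_interval m m' = insert m (insert m' M)"
  proof (intro equalityI subsetI)
    fix k assume "k \<in> cone_interval m m'"
    then have k: "cone_le m k" "cone_le k m'" unfolding cone_interval_def by simp_all
    then have "level k = c \<or> level k = c + 1 \<or> level k = c + 2"
      using cone_le_level[OF k(1)] cone_le_level[OF k(2)] assms(2) unfolding c_def by presburger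
    then show "k \<in> insert m (insert m' M)"
      using cone_le_antisym[OF k(1)] cone_le_antisym[OF k(2)] k assms(2) unfolding M_def c_def by auto
  next
    fix k assume "k \<in> insert m (insert m' M)"
    then show "k \<in> cone_interval m m'"
      using assms(1) unfolding cone_interval_def M_def by (auto simp: cone_le_def)
  qed
  moreover have "m \<notin> insert m' M" "m' \<notin> M"
    using assms(2) unfolding M_def c_def by auto
  ultimately have "card (cone_interval m m') = card J + 2"
    using M \<open>finite M\<close> by simp
  then show thesis
    using d that unfolding J_def i_def[symmetric] i'_def[symmetric]
    by (elim disjE; cases "even c"; simp)
qed

text \<open>By \<open>cone_interval_length_2\<close>, displacement 3 is exactly the failure of the
  count four.\<close>

definition cone_spherical :: "awg \<Rightarrow> awg \<Rightarrow> bool" where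
  "cone_spherical m m' \<longleftrightarrow> (\<forall>k k'. cone_le m k \<longrightarrow> cone_le k k' \<longrightarrow> cone_le k' m' \<longrightarrow>
     level k' = level k + 2 \<longrightarrow> \<bar>column k' - column k\<bar> \<noteq> 3)"

text \<open>A bad length 2 interval with displacement \<open>d\<close> is placed at the bottom; it
  uses up width 3, and the last hypothesis says that \<open>m'\<close> is in the cone above its
  top.\<close>

lemma not_cone_sphericalI:
  assumes "d = 3 \<or> d = - 3" "level m + 2 \<le> level m'"
    "\<bar>column m' - column m - d\<bar> \<le> cone_width (level m') - cone_width (level m) - 3"
  shows "\<not> cone_spherical m m'"
proof -
  have "even (column m + d + (level m + 2) div 2)"
    using even_column[of m] assms(1) by presburger
  then obtain k where k: "column k = column m + d" "level k = level m + 2"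
    using column_level_surj by blast
  have "cone_le m k" "cone_le k m'"
    using assms(1,3) unfolding cone_le_def k cone_width_add_2 by auto
  then show ?thesis
    unfolding cone_spherical_def using k assms(1) cone_le_refl
    by (metis abs_minus_cancel abs_numeral add_diff_cancel_left')
qed

lemma cone_spherical_length_2:
  assumes "cone_le m m'" "level m' = level m + 2"
  shows "cone_spherical m m' \<longleftrightarrow> \<bar>column m' - column m\<bar> = 1"
proof
  assume "cone_spherical m m'"
  then have "\<bar>column m' - column m\<bar> \<noteq> 3"
    using assms cone_le_refl unfolding cone_spherical_def by blast
  then show "\<bar>column m' - column m\<bar> = 1"
    using cone_interval_length_2[OF assms] by blast
next
  assume d: "\<bar>column m' - column m\<bar> = 1"
  show "cone_spherical m m'"
    unfolding cone_spherical_def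
  proof (intro allI impI)
    fix k k' assume k: "cone_le m k" "cone_le k k'" "cone_le k' m'" "level k' = level k + 2"
    then have "m = k" "k' = m'"
      using cone_le_level[of m k] cone_le_level[of k' m'] assms(2) by (auto intro!: cone_le_antisym)
    then show "\<bar>column k' - column k\<bar> \<noteq> 3" using d by simp
  qed
qed

lemma cone_spherical_length_3:
  assumes "cone_le m m'" "level m' = level m + 3"
  shows "cone_spherical m m' \<longleftrightarrow> odd (level m) \<and> column m' = column m"
proof -
  define d where "d = column m' - column m"
  have "cone_width (level m') = cone_width (level m + 1 + 1 + 1)"
    using assms(2) by (simp add: algebra_simps)
  then have width: "cone_width (level m') = cone_width (level m) + (if even (level m) then 5 else 4)"
    unfolding cone_width_Suc by auto
  have d: "\<bar>d\<bar> \<le> (if even (level m) then 5 else 4)"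
    using assms(1) width unfolding cone_le_def d_def by simp
  have par: "even d \<longleftrightarrow> odd (level m)"
    using even_column[of m] even_column[of m'] assms(2) unfolding d_def by presburger
  show ?thesis
  proof
    assume "odd (level m) \<and> column m' = column m"
    then have o: "odd (level m)" and c: "column m' = column m" by simp_all
    show "cone_spherical m m'"
      unfolding cone_spherical_def
    proof (intro allI impI)
      fix k k' assume k: "cone_le m k" "cone_le k k'" "cone_le k' m'" "level k' = level k + 2"
      \<comment> \<open>The subinterval shares an end with the whole interval. The one step left
        over starts at an odd level and moves the column by at most 1; as \<open>m\<close> and
        \<open>m'\<close> share a column, this bounds the displacement by 1 too.\<close>
      then have "level k = level m \<or> level k' = level m'"
        using cone_le_level[of m k] cone_le_level[of k' m'] assms(2) by presburger
      then show "\<bar>column k' - column k\<bar> \<noteq> 3"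
      proof
        assume "level k = level m"
        then have "level m' = level k' + 1" "level k \<le> level m"
          using k(4) assms(2) by linarith+
        then show ?thesis
          using k(3,4) o c cone_width_Suc[of "level k'"] cone_le_antisym[OF k(1)] unfolding cone_le_def by simp
      next
        assume "level k' = level m'"
        then have "level k = level m + 1" "level m' \<le> level k'"
          using k(4) assms(2) by linarith+
        then show ?thesis
          using k(1) o c cone_width_Suc[of "level m"] cone_le_antisym[OF k(3)] unfolding cone_le_def by simp
      qed
    qed
  next
    assume s: "cone_spherical m m'"
    \<comment> \<open>A bad bottom interval fits if \<open>d\<close> is within the remaining width
      of 3 or -3. From an even level this catches every odd \<open>d\<close> up to 5 in size, from
      an odd level every nonzero even \<open>d\<close> up to 4.\<close>
    have "\<not> \<bar>d - 3\<bar> \<le> (if even (level m) then 2 else 1)" "\<not> \<bar>d + 3\<bar> \<le> (if even (level m) then 2 else 1)"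
      using not_cone_sphericalI[of 3 m m'] not_cone_sphericalI[of "- 3" m m'] s width assms(2)
      unfolding d_def by (auto split: if_splits)
    then have "odd (level m) \<and> d = 0"
      using d par by (cases "even (level m)"; simp; presburger)
    then show "odd (level m) \<and> column m' = column m" unfolding d_def by simp
  qed
qed

text \<open>The total width is at least 6, so after a bottom interval with displacement 3 towards
  \<open>m'\<close> the remaining width still reaches \<open>m'\<close>.\<close>

lemma not_cone_spherical_length_gt_3:
  assumes "cone_le m m'" "level m' > level m + 3"
  shows "\<not> cone_spherical m m'"
proof -
  have "cone_width (level m') - cone_width (level m) \<ge> 6"
    using assms(2) unfolding cone_width_def by presburger
  then show ?thesis
    using assms unfolding cone_le_def
    by (intro not_cone_sphericalI[of "if column m \<le> column m' then 3 else - 3"]) auto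
qed

text \<open>The map is a lattice translation. Raising every level by 2e adds 3e to every
  \<open>cone_width\<close>, so cones are preserved, and \<open>di + e\<close> is even, so the
  lattice is preserved.\<close>

lemma cone_automorphism:
  assumes "even (level m) \<longleftrightarrow> even (level m')"
  obtains f where "bij f" "\<And>k k'. cone_le (f k) (f k') \<longleftrightarrow> cone_le k k'" "f m = m'"
proof -
  have shift: "\<exists>k'. column k' = column k + di \<and> level k' = level k + 2 * e"
    if "even (di + e)" for k and di e :: int
  proof -
    have "even (column k + di + (level k + 2 * e) div 2)"
      using even_column[of k] that by (simp add: algebra_simps)
    then show ?thesis using column_level_surj by metis
  qed
  define di where "di = column m' - column m"
  have "even (level m' - level m)" using assms by simp
  then obtain e where "level m' - level m = 2 * e" by (elim evenE)
  then have e: "level m' = level m + 2 * e" by simp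
  have par: "even (di + e)"
    using even_column[of m] even_column[of m'] unfolding di_def e by simp presburger
  obtain f where f: "\<And>k. column (f k) = column k + di" "\<And>k. level (f k) = level k + 2 * e"
    using shift[OF par] by metis
  obtain g where g: "\<And>k. column (g k) = column k - di" "\<And>k. level (g k) = level k - 2 * e"
    using shift[of "- di" "- e"] par by (metis add_uminus_conv_diff even_minus minus_add_distrib mult_minus_right)
  have "f (g k) = k" "g (f k) = k" for k
    by (rule column_level_inject; simp add: f g)+
  then have "bij f" by (metis bijI')
  moreover have "cone_le (f k) (f k') \<longleftrightarrow> cone_le k k'" for k k'
    unfolding cone_le_def f cone_width_def by simp presburger
  moreover have "f m = m'"
    by (rule column_level_inject) (simp_all add: f di_def e)
  ultimately show thesis by (rule that)
qed

section \<open>Simple reflections, ordinary length and cosets in coordinates\<close>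

definition simple_model :: "awg set" where
  "simple_model = {(W_a, 0, 0), (W_b, 0, 0), (W_aba, 1, 1)}"

lemma shi_len_simple:
  assumes "s \<in> simple_model"
  shows "shi_len (awg_mult s m) \<le> shi_len m + 1"
proof -
  obtain w a b where m: "m = (w, a, b)" by (cases m)
  show ?thesis
    using assms unfolding simple_model_def m shi_len_def
    by (elim insertE emptyE; cases w; simp)
qed

text \<open>Together with \<open>shi_len_simple\<close> and \<open>shi_len_eq_0\<close> this makes
  \<open>shi_len\<close> the word length: a letter raises it by at most one, and some letter lowers
  it until the identity is reached.\<close>

lemma shi_len_descent:
  assumes "shi_len m \<noteq> 0"
  obtains s where "s \<in> simple_model" "shi_len (awg_mult s m) = shi_len m - 1"
proof -
  obtain w a b where m: "m = (w, a, b)" by (cases m)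
  have "\<exists>s\<in>simple_model. shi_len (awg_mult s m) = shi_len m - 1"
    using assms unfolding simple_model_def m shi_len_def
    by (cases w; simp; smt (verit))
  then show thesis using that by blast
qed

lemma shi_len_eq_0: "shi_len m = 0 \<Longrightarrow> m = (W_1, 0, 0)"
  by (rule column_level_inject) (auto simp: shi_len_def column_def level_def)

text \<open>The column modulo 3 leaves two possible finite parts, and one simple reflection serves
  both. The list is one period of \<open>\<x>\<close>, so reading that word advances one column per
  letter.\<close>

lemma simple_model_column_up:
  defines "q \<equiv> (\<lambda>n. awg_mult ([(W_b, 0, 0), (W_aba, 1, 1), (W_a, 0, 0)] ! n))"
  shows "column (q (nat (column m mod 3)) m) = column m + 1"
    and "shi_t (q (nat (column m mod 3)) m) = shi_t m"
proof -
  obtain w a b where m: "m = (w, a, b)" by (cases m)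
  have c: "column m = 3 * (a - b) + (neg_b w - neg_a w)"
    unfolding m column_def by simp
  have "column m mod 3 = (neg_b w - neg_a w) mod 3"
    unfolding c by presburger
  then show "column (q (nat (column m mod 3)) m) = column m + 1"
    "shi_t (q (nat (column m mod 3)) m) = shi_t m"
    unfolding q_def by (cases w; simp add: m column_def)+
qed

lemma simple_model_column_down:
  defines "q \<equiv> (\<lambda>n. awg_mult ([(W_a, 0, 0), (W_aba, 1, 1), (W_b, 0, 0)] ! n))"
  shows "column (q (nat (- column m mod 3)) m) = column m - 1"
    and "shi_t (q (nat (- column m mod 3)) m) = shi_t m"
proof -
  obtain w a b where m: "m = (w, a, b)" by (cases m)
  have c: "column m = 3 * (a - b) + (neg_b w - neg_a w)"
    unfolding m column_def by simp
  have "- column m mod 3 = (neg_a w - neg_b w) mod 3"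
    unfolding c by presburger
  then show "column (q (nat (- column m mod 3)) m) = column m - 1"
    "shi_t (q (nat (- column m mod 3)) m) = shi_t m"
    unfolding q_def by (cases w; simp add: m column_def)+
qed

text \<open>If k(\<alpha> + \<beta>) vanishes, the bounds leave 0 or -1 for k(\<alpha>) +
  k(\<beta>), and the parity of the column decides between them.\<close>

lemma shi_t_eq_0_iff: "shi_t m = 0 \<longleftrightarrow> level m = (if even (column m) then 0 else - 1)"
  using shi_t_bounds[of m] unfolding level_def column_def by auto presburger+

text \<open>The absolute values of k(\<alpha>) and k(\<beta>) sum to at least that of their
  difference, and a nonzero third coordinate makes this strict. If it is zero, the two sum to 0 or
  -1, hence do not have the same strict sign, and equality holds.\<close>

lemma shi_len_column:
  shows "shi_t m = 0 \<Longrightarrow> shi_len m = \<bar>column m\<bar>" "shi_t m \<noteq> 0 \<Longrightarrow> \<bar>column m\<bar> < shi_len m"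
  using shi_t_bounds[of m] unfolding shi_len_def column_def by linarith+

text \<open>The right factors are the elements of \<open>U\<close>. A translation by n times the
  coroot of \<alpha> + \<beta> pairs to n with both simple roots, so the column stays and the level
  gains n + n + 2n.\<close>

lemma column_right_mult:
  "column (awg_mult m (W_1, n, n)) = column m" "column (awg_mult m (W_aba, n, n)) = column m"
  "level (awg_mult m (W_1, n, n)) = level m + 4 * n"
  "level (awg_mult m (W_aba, n, n)) = 4 * n - 3 - level m"
proof -
  obtain w a b where m: "m = (w, a, b)" by (cases m)
  show "column (awg_mult m (W_1, n, n)) = column m" "column (awg_mult m (W_aba, n, n)) = column m"
  "level (awg_mult m (W_1, n, n)) = level m + 4 * n"
  "level (awg_mult m (W_aba, n, n)) = 4 * n - 3 - level m"
    unfolding m column_def level_def by (cases w; simp)+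
qed

lemma same_column_iff:
  "column m' = column m \<longleftrightarrow> (\<exists>n. m' = awg_mult m (W_1, n, n) \<or> m' = awg_mult m (W_aba, n, n))"
proof
  assume c: "column m' = column m"
  then have "even (level m div 2) \<longleftrightarrow> even (level m' div 2)"
    using even_column[of m] even_column[of m'] by (metis even_add)
  \<comment> \<open>Within a column the levels lie in {0, 1} or in {2, 3} modulo 4, so two of them
    are congruent or are exchanged by c -> -3 - c.\<close>
  then have "4 dvd level m' - level m \<or> 4 dvd level m' + level m + 3" by presburger
  then obtain n where "level m' - level m = 4 * n \<or> level m' + level m + 3 = 4 * n"
    by (meson dvdE)
  then have "level m' = level (awg_mult m (W_1, n, n)) \<or> level m' = level (awg_mult m (W_aba, n, n))"
    unfolding column_right_mult by linarith
  then show "\<exists>n. m' = awg_mult m (W_1, n, n) \<or> m' = awg_mult m (W_aba, n, n)"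
    using c column_level_inject column_right_mult by metis
qed (auto simp: column_right_mult)

section \<open>Intervals of length 2 and 3 as products of reflections\<close>

text \<open>The pairs \<open>(s\<^bsub>\<delta>-\<gamma>\<^esub>, s\<^bsub>\<gamma>\<^esub>)\<close> of part (1)(a).\<close>

definition double_refl_model :: "(awg \<times> awg) set" where
  "double_refl_model =
    {((W_a, 1, 0), (W_a, 0, 0)), ((W_b, 0, 1), (W_b, 0, 0)), ((W_aba, 1, 1), (W_aba, 0, 0)),
     ((W_a, 0, 0), (W_a, 1, 0)), ((W_b, 0, 0), (W_b, 0, 1)), ((W_aba, 0, 0), (W_aba, 1, 1))}"

text \<open>With \<open>double_refl_column\<close> and the two existence lemmas below, displacement
  1 or 3 separates the two families of length 2 intervals.\<close>

lemma simple_pair_column: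
  assumes "s \<in> simple_model" "s' \<in> simple_model" "s \<noteq> s'"
    "level (awg_mult s (awg_mult s' m)) = level m + 2"
  shows "\<bar>column (awg_mult s (awg_mult s' m)) - column m\<bar> = 1"
proof -
  obtain w a b where m: "m = (w, a, b)" by (cases m)
  show ?thesis
    using assms unfolding simple_model_def m column_def level_def
    by (elim insertE emptyE; cases w; simp)
qed

lemma double_refl_column:
  assumes "(r, r') \<in> double_refl_model" "level (awg_mult r (awg_mult r' m)) = level m + 2"
  shows "\<bar>column (awg_mult r (awg_mult r' m)) - column m\<bar> = 3"
proof -
  obtain w a b where m: "m = (w, a, b)" by (cases m)
  show ?thesis
    using assms unfolding double_refl_model_def m column_def level_def
    by (elim insertE emptyE; cases w; simp)
qed

lemma simple_pair_exists:
  assumes "\<bar>column m' - column m\<bar> = 1" "level m' = level m + 2"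
  obtains s s' where "s \<in> simple_model" "s' \<in> simple_model" "s \<noteq> s'" "m' = awg_mult s (awg_mult s' m)"
proof -
  obtain w a b where m: "m = (w, a, b)" by (cases m)
  obtain d where d: "d = 1 \<or> d = - 1" "column m' = column m + d"
    using assms(1) by (metis abs_if add.commute diff_add_cancel minus_minus)
  have "\<exists>s\<in>simple_model. \<exists>s'\<in>simple_model. s \<noteq> s' \<and>
      column (awg_mult s (awg_mult s' m)) = column m + d \<and>
      level (awg_mult s (awg_mult s' m)) = level m + 2"
    using d(1) unfolding simple_model_def m column_def level_def by (elim disjE; cases w; simp)
  then show thesis
    using column_level_inject[of m'] that d(2) assms(2) by metis
qed

lemma double_refl_exists:
  assumes "\<bar>column m' - column m\<bar> = 3" "level m' = level m + 2"
  obtains r r' where "(r, r') \<in> double_refl_model" "m' = awg_mult r (awg_mult r' m)"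
proof -
  obtain w a b where m: "m = (w, a, b)" by (cases m)
  obtain d where d: "d = 3 \<or> d = - 3" "column m' = column m + d"
    using assms(1) by (metis abs_if add.commute diff_add_cancel minus_minus)
  have "\<exists>p\<in>double_refl_model.
      column (awg_mult (fst p) (awg_mult (snd p) m)) = column m + d \<and>
      level (awg_mult (fst p) (awg_mult (snd p) m)) = level m + 2"
    using d(1) unfolding double_refl_model_def m column_def level_def by (elim disjE; cases w; simp)
  then show thesis
    using column_level_inject[of m'] that d(2) assms(2) by (metis prod.collapse)
qed

text \<open>An odd level forces the finite part to be a reflection. For each of the three, one
  reflection raises the level by 3 within the column, and column and level determine
  \<open>m'\<close>.\<close>

lemma spherical_length_3_model:
  "level m' = level m + 3 \<and> column m' = column m \<and> odd (level m) \<longleftrightarrow>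
    (m' = awg_mult (W_aba, 0, 0) m \<and> (\<exists>a b. m = (W_aba, a, b))) \<or>
    (m' = awg_mult (W_a, 1, 0) m \<and> (\<exists>a b. m = (W_b, a, b))) \<or>
    (m' = awg_mult (W_b, 0, 1) m \<and> (\<exists>a b. m = (W_a, a, b)))" (is "?L \<longleftrightarrow> ?R")
proof
  assume ?R
  then show ?L by (auto simp: column_def level_def)
next
  assume L: ?L
  obtain w a b where m: "m = (w, a, b)" by (cases m)
  \<comment> \<open>The default case serves \<open>W_a\<close> only; the remaining finite parts have
    even level.\<close>
  define r :: awg where "r = (case w of W_aba \<Rightarrow> (W_aba, 0, 0) | W_b \<Rightarrow> (W_a, 1, 0) | _ \<Rightarrow> (W_b, 0, 1))"
  have w: "w = W_aba \<or> w = W_b \<or> w = W_a"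
    using L unfolding m by (cases w) (auto simp: level_def)
  then have "level (awg_mult r m) = level m + 3" "column (awg_mult r m) = column m"
    unfolding m r_def level_def column_def by auto
  then have "m' = awg_mult r m"
    using L by (intro column_level_inject) simp_all
  then show ?R using w unfolding m r_def by auto
qed

section \<open>Inverses and minimal coset representatives\<close>

lemma shi_len_inv: "shi_len (awg_inv m) = shi_len m"
proof -
  obtain w a b where m: "m = (w, a, b)" by (cases m)
  show ?thesis unfolding m shi_len_def by (cases w; simp)
qed

lemma simple_model_inv: "s \<in> simple_model \<Longrightarrow> awg_inv s = s"
  unfolding simple_model_def by auto

text \<open>The element \<open>w(i)\<^sup>-\<^sup>1\<close> of part (2).\<close>

definition column_base :: "int \<Rightarrow> awg" where
  "column_base i = (THE m. column m = i \<and> shi_t m = 0)"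

text \<open>In a given column, \<open>shi_t_eq_0_iff\<close> turns the vanishing of
  \<open>shi_t\<close> into a prescribed level, so the definite description denotes a unique
  element.\<close>

lemma column_base_iff: "m = column_base i \<longleftrightarrow> column m = i \<and> shi_t m = 0"
proof -
  have "even (i + (if even i then 0 else - 1) div 2)" by simp
  then obtain k where k: "column k = i" "level k = (if even i then 0 else - 1)"
    by (rule column_level_surj)
  have iff: "column l = i \<and> shi_t l = 0 \<longleftrightarrow> l = k" for l
  proof
    assume l: "column l = i \<and> shi_t l = 0"
    then have "level l = (if even i then 0 else - 1)" using shi_t_eq_0_iff[of l] by simp
    then show "l = k" using l k by (intro column_level_inject) simp_all
  next
    assume "l = k"
    then show "column l = i \<and> shi_t l = 0" using k shi_t_eq_0_iff[of k] by simp
  qed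
  show ?thesis
    unfolding column_base_def iff by simp
qed

lemma column_base: "column (column_base i) = i" "shi_t (column_base i) = 0"
  "level (column_base i) = (if even i then 0 else - 1)" "shi_len (column_base i) = \<bar>i\<bar>"
  using column_base_iff[of "column_base i" i] shi_t_eq_0_iff[of "column_base i"] shi_len_column(1)[of "column_base i"]
  by auto

text \<open>The coordinates differ by \<open>i\<close> and sum to 0 or -1, so the sign of
  \<open>i\<close> fixes theirs. This confines the inversions of the prefixes.\<close>

lemma column_base_shi:
  "i \<ge> 0 \<Longrightarrow> shi_a (column_base i) \<ge> 0 \<and> shi_b (column_base i) \<le> 0"
  "i \<le> 0 \<Longrightarrow> shi_a (column_base i) \<le> 0 \<and> shi_b (column_base i) \<ge> 0"
  using shi_t_bounds[of "column_base i"] column_base(1,2)[of i] unfolding column_def by linarith+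

lemma awg_mult_column_base:
  "awg_mult ([(W_b, 0, 0), (W_aba, 1, 1), (W_a, 0, 0)] ! (n mod 3)) (column_base (int n)) = column_base (int (Suc n))"
  "awg_mult ([(W_a, 0, 0), (W_aba, 1, 1), (W_b, 0, 0)] ! (n mod 3)) (column_base (- int n)) = column_base (- int (Suc n))"
proof -
  have "nat (int n mod 3) = n mod 3" by (simp add: nat_mod_distrib)
  then show "awg_mult ([(W_b, 0, 0), (W_aba, 1, 1), (W_a, 0, 0)] ! (n mod 3)) (column_base (int n)) = column_base (int (Suc n))"
    "awg_mult ([(W_a, 0, 0), (W_aba, 1, 1), (W_b, 0, 0)] ! (n mod 3)) (column_base (- int n)) = column_base (- int (Suc n))"
    using simple_model_column_up[of "column_base (int n)"] simple_model_column_down[of "column_base (- int n)"]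
    unfolding column_base_iff column_base by simp_all
qed

section \<open>The affine Weyl group as a group of maps\<close>

lemma BijGroup_UNIV_simps:
  "carrier (BijGroup (UNIV :: 'c set)) = {f. bij f}" "\<one>\<^bsub>BijGroup (UNIV :: 'c set)\<^esub> = id"
  "bij f \<Longrightarrow> bij g \<Longrightarrow> f \<otimes>\<^bsub>BijGroup (UNIV :: 'c set)\<^esub> g = f \<circ> g"
  "bij f \<Longrightarrow> inv\<^bsub>BijGroup (UNIV :: 'c set)\<^esub> f = inv_into UNIV f"
proof -
  have Bij: "Bij (UNIV :: 'c set) = {f. bij f}" by (simp add: Bij_def)
  show "carrier (BijGroup (UNIV :: 'c set)) = {f. bij f}" "\<one>\<^bsub>BijGroup (UNIV :: 'c set)\<^esub> = id"
  "bij f \<Longrightarrow> bij g \<Longrightarrow> f \<otimes>\<^bsub>BijGroup (UNIV :: 'c set)\<^esub> g = f \<circ> g"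
  "bij f \<Longrightarrow> inv\<^bsub>BijGroup (UNIV :: 'c set)\<^esub> f = inv_into UNIV f"
    using inv_BijGroup[of f UNIV] by (simp_all add: BijGroup_def Bij id_def compose_def comp_def fun_eq_iff)
qed
lemma word_prod_simps: "word_prod [] = id" "word_prod (f # fs) = f \<circ> word_prod fs"
  unfolding word_prod_def by simp_all

lemma id_in_generate_BijGroup: "id \<in> generate (BijGroup UNIV) S"
  using generate.one[of "BijGroup UNIV" S] unfolding BijGroup_UNIV_simps .

section \<open>The action of the finite Weyl group on V and of the model on V'\<close>

locale A2_plane =
  fixes \<alpha> \<beta> :: "'a::real_inner"
  assumes A2: "A2_simple_roots \<alpha> \<beta>"
begin

lemma inner_simple_roots:
  "\<alpha> \<bullet> \<alpha> > 0" "\<beta> \<bullet> \<beta> = \<alpha> \<bullet> \<alpha>" "\<alpha> \<bullet> \<beta> = - (\<alpha> \<bullet> \<alpha>) / 2" "\<beta> \<bullet> \<alpha> = - (\<alpha> \<bullet> \<alpha>) / 2"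
proof -
  have nz: "\<alpha> \<bullet> \<alpha> \<noteq> 0" "\<beta> \<bullet> \<beta> \<noteq> 0"
    using A2 unfolding A2_simple_roots_def by auto
  then show "\<alpha> \<bullet> \<alpha> > 0" by simp
  show "\<beta> \<bullet> \<beta> = \<alpha> \<bullet> \<alpha>" "\<alpha> \<bullet> \<beta> = - (\<alpha> \<bullet> \<alpha>) / 2"
    using A2 nz unfolding A2_simple_roots_def by (simp_all add: field_simps)
  then show "\<beta> \<bullet> \<alpha> = - (\<alpha> \<bullet> \<alpha>) / 2" by (simp add: inner_commute)
qed

definition pair_a :: "'a \<Rightarrow> real" where "pair_a x = x \<bullet> coroot \<alpha>"
definition pair_b :: "'a \<Rightarrow> real" where "pair_b x = x \<bullet> coroot \<beta>"

lemma pair_linear [simp]: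
  "pair_a (x + y) = pair_a x + pair_a y" "pair_b (x + y) = pair_b x + pair_b y"
  "pair_a (x - y) = pair_a x - pair_a y" "pair_b (x - y) = pair_b x - pair_b y"
  "pair_a (- x) = - pair_a x" "pair_b (- x) = - pair_b x"
  "pair_a (c *\<^sub>R x) = c * pair_a x" "pair_b (c *\<^sub>R x) = c * pair_b x"
  unfolding pair_a_def pair_b_def by (simp_all add: inner_add_left inner_diff_left)

lemma pair_simple_roots [simp]:
  "pair_a \<alpha> = 2" "pair_b \<alpha> = - 1" "pair_a \<beta> = - 1" "pair_b \<beta> = 2"
  using inner_simple_roots unfolding pair_a_def pair_b_def coroot_def by simp_all

definition refl_a :: "'a \<Rightarrow> 'a" where "refl_a x = x - pair_a x *\<^sub>R \<alpha>"
definition refl_b :: "'a \<Rightarrow> 'a" where "refl_b x = x - pair_b x *\<^sub>R \<beta>"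

lemma refl_a_refl_a [simp]: "refl_a (refl_a x) = x"
  unfolding refl_a_def by (simp add: algebra_simps)

lemma refl_b_refl_b [simp]: "refl_b (refl_b x) = x"
  unfolding refl_b_def by (simp add: algebra_simps)

lemma refl_aba: "refl_a (refl_b (refl_a x)) = x - (pair_a x + pair_b x) *\<^sub>R (\<alpha> + \<beta>)"
  unfolding refl_a_def refl_b_def by (simp add: algebra_simps)

lemma refl_braid: "refl_b (refl_a (refl_b x)) = refl_a (refl_b (refl_a x))"
  unfolding refl_aba unfolding refl_a_def refl_b_def by (simp add: algebra_simps)

fun lin :: "weyl \<Rightarrow> 'a \<Rightarrow> 'a" where
  "lin W_1 x = x"
| "lin W_a x = refl_a x"
| "lin W_b x = refl_b x"
| "lin W_ab x = refl_a (refl_b x)"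
| "lin W_ba x = refl_b (refl_a x)"
| "lin W_aba x = refl_a (refl_b (refl_a x))"

lemma lin_left: "lin (left_a w) x = refl_a (lin w x)" "lin (left_b w) x = refl_b (lin w x)"
  by (cases w; simp add: refl_braid)+

lemma lin_mult: "lin (weyl_mult w w') x = lin w (lin w' x)"
  by (cases w) (simp_all add: lin_left)

lemma lin_linear [simp]: "lin w (x + y) = lin w x + lin w y" "lin w (- x) = - lin w x"
  by (cases w; simp add: refl_a_def refl_b_def algebra_simps)+

lemma lin_roots:
  "lin W_a \<alpha> = - \<alpha>" "lin W_b \<alpha> = \<alpha> + \<beta>" "lin W_ab \<alpha> = \<beta>" "lin W_ba \<alpha> = - (\<alpha> + \<beta>)" "lin W_aba \<alpha> = - \<beta>"
  "lin W_a \<beta> = \<alpha> + \<beta>" "lin W_b \<beta> = - \<beta>" "lin W_ab \<beta> = - (\<alpha> + \<beta>)" "lin W_ba \<beta> = \<alpha>" "lin W_aba \<beta> = - \<alpha>"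
  "lin W_a (\<alpha> + \<beta>) = \<beta>" "lin W_b (\<alpha> + \<beta>) = \<alpha>" "lin W_ab (\<alpha> + \<beta>) = - \<alpha>" "lin W_ba (\<alpha> + \<beta>) = - \<beta>"
  "lin W_aba (\<alpha> + \<beta>) = - (\<alpha> + \<beta>)"
  by (simp_all add: refl_a_def refl_b_def algebra_simps scaleR_2)

text \<open>Invariance of the form under the finite Weyl group, the fact that makes
  \<open>awg_map\<close> multiplicative.\<close>

lemma coroot_pull_pair:
  "coroot_pull w (a, b) = (a', b') \<Longrightarrow>
    of_int a * pair_a (lin w x) + of_int b * pair_b (lin w x) = of_int a' * pair_a x + of_int b' * pair_b x"
  by (cases w) (auto simp: refl_a_def refl_b_def algebra_simps)

text \<open>The translation acts first and only adds a multiple of \<delta>, which \<open>w\<close>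
  fixes; hence the pairings are taken with the original \<open>fst z\<close>.\<close>

fun awg_map :: "awg \<Rightarrow> 'a \<times> real \<Rightarrow> 'a \<times> real" where
  "awg_map (w, a, b) z = (lin w (fst z), snd z + (of_int a * pair_a (fst z) + of_int b * pair_b (fst z)))"

lemma awg_map_mult: "awg_map (awg_mult m m') = awg_map m \<circ> awg_map m'"
proof -
  obtain w a b where m: "m = (w, a, b)" by (cases m)
  obtain w' a' b' where m': "m' = (w', a', b')" by (cases m')
  obtain c d where c: "coroot_pull w' (a, b) = (c, d)" by (cases "coroot_pull w' (a, b)")
  show ?thesis
    unfolding m m' by (rule ext) (simp add: c lin_mult coroot_pull_pair[OF c] algebra_simps)
qed

lemma awg_map_one: "awg_map (W_1, 0, 0) = id"
  by (rule ext) simp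

lemma awg_map_inv: "bij (awg_map m)" "inv_into UNIV (awg_map m) = awg_map (awg_inv m)"
proof -
  have 1: "awg_map m \<circ> awg_map (awg_inv m) = id" "awg_map (awg_inv m) \<circ> awg_map m = id"
    unfolding awg_map_mult[symmetric] awg_mult_inv awg_map_one by simp_all
  then show "bij (awg_map m)" by (rule o_bij[rotated])
  from 1 show "inv_into UNIV (awg_map m) = awg_map (awg_inv m)"
    by (intro inv_unique_comp)
qed

text \<open>The six finite parts send \<alpha> to six different roots, and the \<delta>-components
  at \<alpha> and \<beta> give 2a - b and 2b - a, which determine a and b.\<close>

lemma inj_awg_map: "inj awg_map"
proof (rule injI)
  fix m m' assume eq: "awg_map m = awg_map m'"
  obtain w a b where m: "m = (w, a, b)" by (cases m)
  obtain w' a' b' where m': "m' = (w', a', b')" by (cases m')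
  have "lin w \<alpha> = lin w' \<alpha>" "of_int (2 * a - b) = (of_int (2 * a' - b') :: real)"
    "lin w \<beta> = lin w' \<beta>" "of_int (2 * b - a) = (of_int (2 * b' - a') :: real)"
    using fun_cong[OF eq, of "(\<alpha>, 0)"] fun_cong[OF eq, of "(\<beta>, 0)"] unfolding m m' by simp_all
  then have "a = a'" "b = b'" "(pair_a (lin w \<alpha>), pair_b (lin w \<alpha>)) = (pair_a (lin w' \<alpha>), pair_b (lin w' \<alpha>))"
    unfolding of_int_eq_iff by (linarith, linarith, simp)
  then show "m = m'"
    unfolding m m' by (cases w; cases w'; simp add: lin_roots del: lin.simps(2-))
qed

lemma aff_reflection_uminus: "aff_reflection (- \<gamma>) = aff_reflection (\<gamma> :: 'a \<times> real)"
  by (rule ext) (simp add: aff_reflection_def aff_form_def)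

text \<open>The reflection in \<gamma> + n \<delta> also subtracts n times the pairing with the
  coroot of \<gamma> along \<delta>, a translation by -n coroots. As all roots have equal length,
  the coroot of \<alpha> + \<beta> is the sum of the simple coroots.\<close>

lemma aff_reflection_awg_map:
  "aff_reflection (\<alpha>, of_int n) = awg_map (W_a, - n, 0)"
  "aff_reflection (\<beta>, of_int n) = awg_map (W_b, 0, - n)"
  "aff_reflection (\<alpha> + \<beta>, of_int n) = awg_map (W_aba, - n, - n)"
proof -
  have "(\<alpha> + \<beta>) \<bullet> (\<alpha> + \<beta>) = \<alpha> \<bullet> \<alpha>"
    by (simp add: inner_add_left inner_add_right inner_simple_roots)
  then have "2 * (x \<bullet> (\<alpha> + \<beta>)) / ((\<alpha> + \<beta>) \<bullet> (\<alpha> + \<beta>)) = pair_a x + pair_b x"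
    "2 * (x \<bullet> \<alpha>) / (\<alpha> \<bullet> \<alpha>) = pair_a x" "2 * (x \<bullet> \<beta>) / (\<beta> \<bullet> \<beta>) = pair_b x" for x
    using inner_simple_roots unfolding pair_a_def pair_b_def coroot_def
    by (simp_all add: inner_add_right field_simps)
  then have eq: "aff_reflection (\<alpha>, r) z = z - pair_a (fst z) *\<^sub>R (\<alpha>, r)"
    "aff_reflection (\<beta>, r) z = z - pair_b (fst z) *\<^sub>R (\<beta>, r)"
    "aff_reflection (\<alpha> + \<beta>, r) z = z - (pair_a (fst z) + pair_b (fst z)) *\<^sub>R (\<alpha> + \<beta>, r)" for z r
    unfolding aff_reflection_def aff_form_def fst_conv by (simp_all only:)
  show "aff_reflection (\<alpha>, of_int n) = awg_map (W_a, - n, 0)"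
  "aff_reflection (\<beta>, of_int n) = awg_map (W_b, 0, - n)"
  "aff_reflection (\<alpha> + \<beta>, of_int n) = awg_map (W_aba, - n, - n)"
    by (simp_all add: fun_eq_iff eq refl_aba refl_a_def refl_b_def algebra_simps)
qed

lemma distinct_Phi: "distinct [\<alpha>, \<beta>, \<alpha> + \<beta>, - \<alpha>, - \<beta>, - (\<alpha> + \<beta>)]"
proof -
  have "distinct (map (\<lambda>x. (pair_a x, pair_b x)) [\<alpha>, \<beta>, \<alpha> + \<beta>, - \<alpha>, - \<beta>, - (\<alpha> + \<beta>)])"
    by simp
  then show ?thesis unfolding distinct_map by blast
qed

lemma mem_aff_pos_roots:
  "(\<gamma>, r) \<in> aff_pos_roots \<alpha> \<beta> \<longleftrightarrow>
    \<gamma> \<in> {\<alpha>, \<beta>, \<alpha> + \<beta>} \<and> (\<exists>n::nat. r = real n) \<or> \<gamma> \<in> {- \<alpha>, - \<beta>, - (\<alpha> + \<beta>)} \<and> (\<exists>n::nat. r = real n + 1)"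
  unfolding aff_pos_roots_def aff_hat_def Phi_def Phi_neg_def Phi_pos_def \<delta>_def by auto

lemma mem_aff_pos_roots_int:
  "\<gamma> \<in> {\<alpha>, \<beta>, \<alpha> + \<beta>} \<Longrightarrow> (\<gamma>, of_int n) \<in> aff_pos_roots \<alpha> \<beta> \<longleftrightarrow> 0 \<le> n"
  "\<gamma> \<in> {\<alpha>, \<beta>, \<alpha> + \<beta>} \<Longrightarrow> (- \<gamma>, of_int n) \<in> aff_pos_roots \<alpha> \<beta> \<longleftrightarrow> 1 \<le> n"
proof -
  have "(\<exists>k::nat. (of_int n :: real) = real k) \<longleftrightarrow> 0 \<le> n"
    by (metis of_int_of_nat_eq of_int_eq_iff zero_le_imp_eq_int of_nat_0_le_iff)
  moreover have "(\<exists>k::nat. (of_int n :: real) = real k + 1) \<longleftrightarrow> 1 \<le> n"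
  proof -
    have "(\<exists>k::nat. (of_int n :: real) = real k + 1) \<longleftrightarrow> (\<exists>k::nat. n = int k + 1)"
      by (metis of_int_of_nat_eq of_int_eq_iff of_int_add of_int_1)
    also have "\<dots> \<longleftrightarrow> 1 \<le> n"
      by (metis add.commute le_add_same_cancel1 of_nat_0_le_iff zle_iff_zadd)
    finally show ?thesis .
  qed
  moreover assume "\<gamma> \<in> {\<alpha>, \<beta>, \<alpha> + \<beta>}"
  ultimately show "(\<gamma>, of_int n) \<in> aff_pos_roots \<alpha> \<beta> \<longleftrightarrow> 0 \<le> n" "(- \<gamma>, of_int n) \<in> aff_pos_roots \<alpha> \<beta> \<longleftrightarrow> 1 \<le> n"
    unfolding mem_aff_pos_roots using distinct_Phi by (auto simp del: minus_add_distrib)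
qed

declare awg_map.simps [simp del]

lemma mem_aff_roots:
  "\<gamma> \<in> aff_roots \<alpha> \<beta> \<longleftrightarrow>
    (\<exists>n::int. \<exists>\<rho>\<in>{\<alpha>, \<beta>, \<alpha> + \<beta>}. \<gamma> = (\<rho>, of_int n) \<or> \<gamma> = - (\<rho>, of_int n))"
proof -
  have roots: "aff_roots \<alpha> \<beta> = aff_pos_roots \<alpha> \<beta> \<union> uminus ` aff_pos_roots \<alpha> \<beta>"
    unfolding aff_roots_def aff_pos_roots_def ..
  have "\<exists>n::int. \<exists>\<rho>\<in>{\<alpha>, \<beta>, \<alpha> + \<beta>}. \<gamma> = (\<rho>, of_int n) \<or> \<gamma> = - (\<rho>, of_int n)"
    if pos: "\<gamma> \<in> aff_pos_roots \<alpha> \<beta>" for \<gamma>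
  proof -
    obtain \<rho> r where \<gamma>: "\<gamma> = (\<rho>, r)" by (cases \<gamma>)
    consider n :: nat where "\<rho> \<in> {\<alpha>, \<beta>, \<alpha> + \<beta>}" "r = real n"
      | n :: nat where "- \<rho> \<in> {\<alpha>, \<beta>, \<alpha> + \<beta>}" "r = real n + 1"
      using pos unfolding \<gamma> mem_aff_pos_roots by auto
    then show ?thesis
    proof cases
      case 1
      then show ?thesis unfolding \<gamma> by (intro exI[of _ "int n"] bexI[of _ \<rho>]) auto
    next
      case 2
      then show ?thesis unfolding \<gamma> by (intro exI[of _ "- int n - 1"] bexI[of _ "- \<rho>"]) auto
    qed
  qed
  moreover have "(\<rho>, of_int n) \<in> aff_roots \<alpha> \<beta>" "- (\<rho>, of_int n) \<in> aff_roots \<alpha> \<beta>"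
    if "\<rho> \<in> {\<alpha>, \<beta>, \<alpha> + \<beta>}" for \<rho> n
  proof -
    have "(\<rho>, of_int n) \<in> aff_pos_roots \<alpha> \<beta> \<or> - (\<rho>, of_int n) \<in> aff_pos_roots \<alpha> \<beta>"
      using mem_aff_pos_roots_int[OF that, of n] mem_aff_pos_roots_int[OF that, of "- n"] by force
    then show "(\<rho>, of_int n) \<in> aff_roots \<alpha> \<beta>" "- (\<rho>, of_int n) \<in> aff_roots \<alpha> \<beta>"
      unfolding roots by (metis UnCI imageI minus_minus)+
  qed
  moreover have "\<gamma> \<in> aff_pos_roots \<alpha> \<beta> \<or> - \<gamma> \<in> aff_pos_roots \<alpha> \<beta>" if "\<gamma> \<in> aff_roots \<alpha> \<beta>"
    using that unfolding roots by auto
  ultimately show ?thesis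
    by (metis minus_minus)
qed

lemma aff_reflection_image: "aff_reflection ` aff_roots \<alpha> \<beta> = awg_map ` refl_model"
proof (intro equalityI subsetI)
  fix f assume "f \<in> aff_reflection ` aff_roots \<alpha> \<beta>"
  then obtain n :: int and \<rho> where "\<rho> \<in> {\<alpha>, \<beta>, \<alpha> + \<beta>}" "f = aff_reflection (\<rho>, of_int n)"
    unfolding image_iff Bex_def mem_aff_roots using aff_reflection_uminus by metis
  then have "f \<in> awg_map ` {(W_a, - n, 0), (W_b, 0, - n), (W_aba, - n, - n)}"
    using aff_reflection_awg_map by auto
  then show "f \<in> awg_map ` refl_model"
    unfolding refl_model_def by blast
next
  fix f assume "f \<in> awg_map ` refl_model"
  then obtain n where "f \<in> awg_map ` {(W_a, - (- n), 0), (W_b, 0, - (- n)), (W_aba, - (- n), - (- n))}"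
    unfolding refl_model_def by auto
  then have "f \<in> aff_reflection ` {(\<alpha>, of_int (- n)), (\<beta>, of_int (- n)), (\<alpha> + \<beta>, of_int (- n))}"
    by (simp only: image_insert image_empty aff_reflection_awg_map)
  then obtain \<rho> where "\<rho> \<in> {\<alpha>, \<beta>, \<alpha> + \<beta>}" "f = aff_reflection (\<rho>, of_int (- n))"
    by blast
  then show "f \<in> aff_reflection ` aff_roots \<alpha> \<beta>"
    unfolding image_iff Bex_def mem_aff_roots by blast
qed

lemma simple_reflection_awg_map:
  "aff_reflection (\<alpha>, 0) = awg_map (W_a, 0, 0)"
  "aff_reflection (\<beta>, 0) = awg_map (W_b, 0, 0)"
  "aff_reflection (\<alpha> + \<beta>, 0) = awg_map (W_aba, 0, 0)"
  "aff_reflection (\<delta> - (\<alpha>, 0)) = awg_map (W_a, 1, 0)"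
  "aff_reflection (\<delta> - (\<beta>, 0)) = awg_map (W_b, 0, 1)"
  "aff_reflection (\<delta> - (\<alpha> + \<beta>, 0)) = awg_map (W_aba, 1, 1)"
  "aff_reflection (\<delta> - (\<alpha>, 0) - (\<beta>, 0)) = awg_map (W_aba, 1, 1)"
proof -
  have "\<delta> - (\<alpha>, 0) = - (\<alpha>, - 1)" "\<delta> - (\<beta>, 0) = - (\<beta>, - 1)" "\<delta> - (\<alpha> + \<beta>, 0) = - (\<alpha> + \<beta>, - 1)"
    "\<delta> - (\<alpha>, 0) - (\<beta>, 0) = - (\<alpha> + \<beta>, - 1)"
    unfolding \<delta>_def by simp_all
  then show "aff_reflection (\<alpha>, 0) = awg_map (W_a, 0, 0)"
  "aff_reflection (\<beta>, 0) = awg_map (W_b, 0, 0)"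
  "aff_reflection (\<alpha> + \<beta>, 0) = awg_map (W_aba, 0, 0)"
  "aff_reflection (\<delta> - (\<alpha>, 0)) = awg_map (W_a, 1, 0)"
  "aff_reflection (\<delta> - (\<beta>, 0)) = awg_map (W_b, 0, 1)"
  "aff_reflection (\<delta> - (\<alpha> + \<beta>, 0)) = awg_map (W_aba, 1, 1)"
  "aff_reflection (\<delta> - (\<alpha>, 0) - (\<beta>, 0)) = awg_map (W_aba, 1, 1)"
    using aff_reflection_awg_map[of 0] aff_reflection_awg_map[of "- 1"]
    by (simp_all only: aff_reflection_uminus of_int_0 of_int_minus of_int_1 minus_zero minus_minus)
qed

lemma simple_refls_eq: "simple_refls \<alpha> \<beta> = awg_map ` simple_model"
  unfolding simple_refls_def simple_model_def simple_reflection_awg_map by simp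

section \<open>Ordinary length and generated subgroups\<close>

lemma word_prod_awg_map:
  "set ss \<subseteq> simple_refls \<alpha> \<beta> \<Longrightarrow> \<exists>m. word_prod ss = awg_map m \<and> shi_len m \<le> int (length ss)"
proof (induction ss)
  case Nil
  show ?case
    by (rule exI[of _ "(W_1, 0, 0)"]) (simp add: word_prod_def awg_map_one shi_len_def)
next
  case (Cons f ss)
  then obtain s m where "s \<in> simple_model" "f = awg_map s" "word_prod ss = awg_map m" "shi_len m \<le> int (length ss)"
    unfolding simple_refls_eq by auto
  then show ?case
    using shi_len_simple[of s m]
    by (intro exI[of _ "awg_mult s m"]) (simp add: word_prod_def awg_map_mult)
qed

lemma reduced_word_exists:
  "\<exists>ss. set ss \<subseteq> simple_refls \<alpha> \<beta> \<and> int (length ss) = shi_len m \<and> word_prod ss = awg_map m"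
proof (induction "nat (shi_len m)" arbitrary: m)
  case 0
  then have "shi_len m = 0" unfolding shi_len_def by simp
  then show ?case
    by (intro exI[of _ "[]"]) (auto simp: word_prod_def awg_map_one[symmetric] dest: shi_len_eq_0)
next
  case (Suc n)
  then have "shi_len m \<noteq> 0" by auto
  then obtain s where s: "s \<in> simple_model" "shi_len (awg_mult s m) = shi_len m - 1"
    by (rule shi_len_descent)
  have "n = nat (shi_len (awg_mult s m))" using s(2) Suc.hyps(2) by simp
  then obtain ss where ss: "set ss \<subseteq> simple_refls \<alpha> \<beta>" "int (length ss) = shi_len m - 1"
    "word_prod ss = awg_map (awg_mult s m)"
    using Suc.hyps(1) s(2) by metis
  have "awg_mult s s = (W_1, 0, 0)"
    using s(1) unfolding simple_model_def by auto
  then have "awg_map s \<circ> awg_map (awg_mult s m) = awg_map m"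
    unfolding awg_map_mult comp_assoc[symmetric] by (metis awg_map_mult awg_map_one id_comp)
  then show ?case
    using ss s(1) by (intro exI[of _ "awg_map s # ss"]) (auto simp: word_prod_def simple_refls_eq)
qed

text \<open>No word is shorter than \<open>shi_len\<close>, since a letter raises it by at most one;
  the descent produces a word attaining it.\<close>

lemma cox_len_awg_map: "int (cox_len \<alpha> \<beta> (awg_map m)) = shi_len m"
proof -
  obtain ss where ss: "set ss \<subseteq> simple_refls \<alpha> \<beta>" "int (length ss) = shi_len m" "word_prod ss = awg_map m"
    using reduced_word_exists by blast
  have "cox_len \<alpha> \<beta> (awg_map m) = length ss"
    unfolding cox_len_def
  proof (rule Least_equality)
    show "\<exists>ts. set ts \<subseteq> simple_refls \<alpha> \<beta> \<and> length ts = length ss \<and> word_prod ts = awg_map m"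
      using ss by blast
  next
    fix n assume "\<exists>ts. set ts \<subseteq> simple_refls \<alpha> \<beta> \<and> length ts = n \<and> word_prod ts = awg_map m"
    then show "length ss \<le> n"
      using word_prod_awg_map ss(2) injD[OF inj_awg_map] by (metis of_nat_le_iff)
  qed
  then show ?thesis using ss(2) by simp
qed

text \<open>Bounds a generated subgroup from above; used for the affine Weyl group, its translations
  and \<open>U\<close>.\<close>

lemma generate_subset_awg_map:
  assumes "S \<subseteq> awg_map ` M" "(W_1, 0, 0) \<in> M"
    "\<And>m m'. m \<in> M \<Longrightarrow> m' \<in> M \<Longrightarrow> awg_mult m m' \<in> M" "\<And>m. m \<in> M \<Longrightarrow> awg_inv m \<in> M"
  shows "generate (BijGroup UNIV) S \<subseteq> awg_map ` M"
proof
  fix f assume "f \<in> generate (BijGroup UNIV) S"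
  then show "f \<in> awg_map ` M"
  proof induction
    case one
    then show ?case using assms(2) awg_map_one unfolding BijGroup_UNIV_simps by (metis imageI)
  next
    case (incl h)
    then show ?case using assms(1) by blast
  next
    case (inv h)
    then obtain m where "m \<in> M" "h = awg_map m" using assms(1) by blast
    then show ?case using assms(4) by (auto simp: BijGroup_UNIV_simps awg_map_inv)
  next
    case (eng h1 h2)
    then obtain m m' where "m \<in> M" "h1 = awg_map m" "m' \<in> M" "h2 = awg_map m'" by blast
    then have "h1 \<otimes>\<^bsub>BijGroup UNIV\<^esub> h2 = awg_map (awg_mult m m')" "awg_mult m m' \<in> M"
      using assms(3) unfolding awg_map_mult by (simp_all only: BijGroup_UNIV_simps awg_map_inv)
    then show ?case by blast
  qed
qed

lemma generate_comp:
  assumes "S \<subseteq> range awg_map" "f \<in> generate (BijGroup UNIV) S" "g \<in> generate (BijGroup UNIV) S"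
  shows "f \<circ> g \<in> generate (BijGroup UNIV) S"
proof -
  have "generate (BijGroup UNIV) S \<subseteq> range awg_map"
    using assms(1) by (intro generate_subset_awg_map) simp_all
  then have "bij f" "bij g" using assms awg_map_inv by blast+
  then show ?thesis
    using generate.eng[OF assms(2,3)] by (simp add: BijGroup_UNIV_simps)
qed

text \<open>The reflections all lie in the model; conversely each model element has a word in simple
  reflections, which are among the generators.\<close>

lemma aff_Weyl_eq: "aff_Weyl \<alpha> \<beta> = range awg_map"
proof
  let ?R = "aff_reflection ` aff_roots \<alpha> \<beta>"
  have R: "?R \<subseteq> range awg_map" unfolding aff_reflection_image by blast
  show "aff_Weyl \<alpha> \<beta> \<subseteq> range awg_map"
    unfolding aff_Weyl_def using R by (intro generate_subset_awg_map) simp_all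
  have "simple_refls \<alpha> \<beta> \<subseteq> ?R"
    unfolding simple_refls_eq aff_reflection_image simple_model_def refl_model_def by blast
  then have "word_prod ss \<in> generate (BijGroup UNIV) ?R" if "set ss \<subseteq> simple_refls \<alpha> \<beta>" for ss
    using that
  proof (induction ss)
    case Nil
    show ?case unfolding word_prod_simps by (rule id_in_generate_BijGroup)
  next
    case (Cons f ss)
    then have "f \<circ> word_prod ss \<in> generate (BijGroup UNIV) ?R"
      by (intro generate_comp[OF R]) (auto intro: generate.incl)
    then show ?case unfolding word_prod_simps .
  qed
  then show "range awg_map \<subseteq> aff_Weyl \<alpha> \<beta>"
    unfolding aff_Weyl_def using reduced_word_exists by (metis image_subsetI)
qed

lemma translations_subset_generate:
  assumes S: "S \<subseteq> range awg_map" and c: "awg_map (W_1, c, d) \<in> generate (BijGroup UNIV) S"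
  shows "awg_map (W_1, n * c, n * d) \<in> generate (BijGroup UNIV) S"
proof -
  have "group (BijGroup (UNIV :: ('a \<times> real) set))" by (rule group_BijGroup)
  moreover have "S \<subseteq> carrier (BijGroup UNIV)"
    using S awg_map_inv by (auto simp: BijGroup_UNIV_simps)
  ultimately have "inv_into UNIV (awg_map (W_1, c, d)) \<in> generate (BijGroup UNIV) S"
    using group.generate_m_inv_closed[OF _ _ c] by (simp add: BijGroup_UNIV_simps awg_map_inv)
  then have c': "awg_map (W_1, - c, - d) \<in> generate (BijGroup UNIV) S"
    by (simp add: awg_map_inv)
  show ?thesis
  proof (induction n rule: int_induct[where k = 0])
    case base
    show ?case unfolding mult_zero_left awg_map_one by (rule id_in_generate_BijGroup)
  next
    case (step1 i)
    then show ?case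
      using generate_comp[OF S c, of "awg_map (W_1, i * c, i * d)"]
      by (simp add: awg_map_mult[symmetric] algebra_simps)
  next
    case (step2 i)
    then show ?case
      using generate_comp[OF S c', of "awg_map (W_1, i * c, i * d)"]
      by (simp add: awg_map_mult[symmetric] algebra_simps)
  qed
qed

lemma transl_group_eq: "transl_group \<alpha> \<beta> = awg_map ` ({W_1} \<times> UNIV)"
proof
  let ?S = "{transl (coroot \<alpha>), transl (coroot \<beta>)}"
  have t: "transl (coroot \<alpha>) = awg_map (W_1, 1, 0)" "transl (coroot \<beta>) = awg_map (W_1, 0, 1)"
    by (simp_all add: fun_eq_iff awg_map.simps transl_def aff_form_def \<delta>_def pair_a_def pair_b_def)
  have S: "?S \<subseteq> range awg_map" unfolding t by blast
  show "transl_group \<alpha> \<beta> \<subseteq> awg_map ` ({W_1} \<times> UNIV)"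
    unfolding transl_group_def t by (rule generate_subset_awg_map) (auto)
  have "awg_map (W_1, a * 1, a * 0) \<in> transl_group \<alpha> \<beta>" "awg_map (W_1, b * 0, b * 1) \<in> transl_group \<alpha> \<beta>" for a b
    unfolding transl_group_def using t S by (intro translations_subset_generate; auto intro: generate.incl)+
  then have "awg_map (W_1, a, 0) \<circ> awg_map (W_1, 0, b) \<in> transl_group \<alpha> \<beta>" for a b
    unfolding transl_group_def using generate_comp[OF S] by simp
  then show "awg_map ` ({W_1} \<times> UNIV) \<subseteq> transl_group \<alpha> \<beta>"
    unfolding awg_map_mult[symmetric] by (auto)
qed

text \<open>The product of the two reflections is a translation by the coroot of \<alpha> + \<beta>;
  its powers, and their products with the finite reflection, exhaust the group.\<close>

lemma dihedral_eq:
  "generate (BijGroup UNIV) {awg_map (W_aba, 1, 1), awg_map (W_aba, 0, 0)} = awg_map ` ({W_1, W_aba} \<times> range (\<lambda>n. (n, n)))"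
  (is "generate _ ?S = _")
proof
  have S: "?S \<subseteq> range awg_map" by blast
  show "generate (BijGroup UNIV) ?S \<subseteq> awg_map ` ({W_1, W_aba} \<times> range (\<lambda>n. (n, n)))"
    by (rule generate_subset_awg_map) (auto)
  have u: "awg_map (W_aba, 0, 0) \<in> generate (BijGroup UNIV) ?S" by (auto intro: generate.incl)
  have "awg_map (W_aba, 0, 0) \<circ> awg_map (W_aba, 1, 1) \<in> generate (BijGroup UNIV) ?S"
    by (intro generate_comp[OF S]) (auto intro: generate.incl)
  then have t: "awg_map (W_1, n * 1, n * 1) \<in> generate (BijGroup UNIV) ?S" for n
    by (intro translations_subset_generate[OF S]) (simp add: awg_map_mult[symmetric])
  then have "awg_map (W_aba, 0, 0) \<circ> awg_map (W_1, n * 1, n * 1) \<in> generate (BijGroup UNIV) ?S" for n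
    by (intro generate_comp[OF S] u)
  then show "awg_map ` ({W_1, W_aba} \<times> range (\<lambda>n. (n, n))) \<subseteq> generate (BijGroup UNIV) ?S"
    using t by (auto simp: awg_map_mult[symmetric])
qed

section \<open>Inversion sets and the twisted order\<close>

definition tw_B :: "('a \<times> real) set" where
  "tw_B = aff_hat \<alpha> \<beta> {\<alpha>, \<alpha> + \<beta>, \<beta>}"

lemma mem_tw_B: "(\<gamma>, r) \<in> tw_B \<longleftrightarrow> \<gamma> \<in> {\<alpha>, \<beta>, \<alpha> + \<beta>} \<and> (\<exists>n::nat. r = real n)"
  using distinct_Phi unfolding tw_B_def aff_hat_def Phi_neg_def Phi_pos_def \<delta>_def by auto

lemma awg_map_roots:
  "awg_map (w, a, b) (\<alpha>, of_int n) = (lin w \<alpha>, of_int (n + 2 * a - b))"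
  "awg_map (w, a, b) (\<beta>, of_int n) = (lin w \<beta>, of_int (n + 2 * b - a))"
  "awg_map (w, a, b) (\<alpha> + \<beta>, of_int n) = (lin w (\<alpha> + \<beta>), of_int (n + a + b))"
  by (simp_all add: awg_map.simps algebra_simps)

lemma awg_map_uminus: "awg_map m (- \<gamma>) = - awg_map m \<gamma>"
  by (cases m; cases \<gamma>) (simp add: awg_map.simps)

lemma mem_uminus_aff_pos_roots:
  assumes "\<gamma> \<in> {\<alpha>, \<beta>, \<alpha> + \<beta>}"
  shows "(\<gamma>, of_int n) \<in> uminus ` aff_pos_roots \<alpha> \<beta> \<longleftrightarrow> n < 0"
    "(- \<gamma>, of_int n) \<in> uminus ` aff_pos_roots \<alpha> \<beta> \<longleftrightarrow> n \<le> 0"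
proof -
  have uminus: "x \<in> uminus ` A \<longleftrightarrow> - x \<in> A" for x :: "'a \<times> real" and A
    by (metis image_eqI imageE minus_minus)
  show "(\<gamma>, of_int n) \<in> uminus ` aff_pos_roots \<alpha> \<beta> \<longleftrightarrow> n < 0"
    "(- \<gamma>, of_int n) \<in> uminus ` aff_pos_roots \<alpha> \<beta> \<longleftrightarrow> n \<le> 0"
    unfolding uminus using mem_aff_pos_roots_int[OF assms, of "- n"] by auto
qed

text \<open>The image of \<gamma> + n \<delta> has \<delta>-part n plus the pairing. It is negative
  if this is below 0, or already at 0 when \<open>w\<close> makes \<gamma> negative; that shift is
  the correction in the Shi coordinates.\<close>

lemma awg_map_negative_iff:
  "awg_map m (\<alpha>, of_int n) \<in> uminus ` aff_pos_roots \<alpha> \<beta> \<longleftrightarrow> n < - shi_a m"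
  "awg_map m (\<beta>, of_int n) \<in> uminus ` aff_pos_roots \<alpha> \<beta> \<longleftrightarrow> n < - shi_b m"
  "awg_map m (\<alpha> + \<beta>, of_int n) \<in> uminus ` aff_pos_roots \<alpha> \<beta> \<longleftrightarrow> n < - shi_t m"
proof -
  obtain w a b where m: "m = (w, a, b)" by (cases m)
  show "awg_map m (\<alpha>, of_int n) \<in> uminus ` aff_pos_roots \<alpha> \<beta> \<longleftrightarrow> n < - shi_a m"
  "awg_map m (\<beta>, of_int n) \<in> uminus ` aff_pos_roots \<alpha> \<beta> \<longleftrightarrow> n < - shi_b m"
  "awg_map m (\<alpha> + \<beta>, of_int n) \<in> uminus ` aff_pos_roots \<alpha> \<beta> \<longleftrightarrow> n < - shi_t m"
    unfolding m awg_map_roots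
    by (cases w; simp only: lin_roots lin.simps(1) mem_uminus_aff_pos_roots insert_iff simp_thms; auto)+
qed

text \<open>Inversions of the inverse: this is the set entering \<open>tw_len\<close>.\<close>

definition inversions :: "awg \<Rightarrow> ('a \<times> real) set" where
  "inversions m = inv_set \<alpha> \<beta> (inv_into UNIV (awg_map m))"

lemma mem_inversions:
  "\<gamma> \<in> inversions m \<longleftrightarrow> \<gamma> \<in> aff_pos_roots \<alpha> \<beta> \<and> awg_map m \<gamma> \<in> uminus ` aff_pos_roots \<alpha> \<beta>"
  unfolding inversions_def inv_set_def inv_inv_eq[OF awg_map_inv(1)] by simp

text \<open>A negative coordinate counts inversions on the ray of \<rho>, a positive one on the ray
  of -\<rho>. The second ray starts at -\<rho> + \<delta>, hence the offset.\<close>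

lemma inversions_int_iff:
  assumes "(\<rho>, e) \<in> {(\<alpha>, shi_a m), (\<beta>, shi_b m), (\<alpha> + \<beta>, shi_t m)}"
  shows "(\<rho>, of_int n) \<in> inversions m \<longleftrightarrow> 0 \<le> n \<and> n < - e"
    "(- \<rho>, of_int n) \<in> inversions m \<longleftrightarrow> 1 \<le> n \<and> n \<le> e"
proof -
  have \<rho>: "\<rho> \<in> {\<alpha>, \<beta>, \<alpha> + \<beta>}" using assms by auto
  have neg: "awg_map m (\<rho>, of_int n) \<in> uminus ` aff_pos_roots \<alpha> \<beta> \<longleftrightarrow> n < - e" for n
    using assms awg_map_negative_iff[of m n] by auto
  then show "(\<rho>, of_int n) \<in> inversions m \<longleftrightarrow> 0 \<le> n \<and> n < - e"
    unfolding mem_inversions using mem_aff_pos_roots_int[OF \<rho>] by simp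
  have "awg_map m (- \<rho>, of_int n) \<in> uminus ` aff_pos_roots \<alpha> \<beta> \<longleftrightarrow> n \<le> e"
  proof -
    have "awg_map m (- \<rho>, of_int n) = - awg_map m (\<rho>, of_int (- n))"
      using awg_map_uminus[of m "(\<rho>, of_int (- n))"] by simp
    \<comment> \<open>For vectors of this form exactly one of the vector and its negative is
      positive, which converts the test on -\<rho> into the one on \<rho>.\<close>
    moreover obtain \<sigma> k where \<sigma>: "\<sigma> \<in> {\<alpha>, \<beta>, \<alpha> + \<beta>}"
      "awg_map m (\<rho>, of_int (- n)) = (\<sigma>, of_int k) \<or> awg_map m (\<rho>, of_int (- n)) = (- \<sigma>, of_int k)"
    proof -
      obtain w a b where m: "m = (w, a, b)" by (cases m)
      have "\<exists>\<sigma>\<in>{\<alpha>, \<beta>, \<alpha> + \<beta>}. lin w \<rho> = \<sigma> \<or> lin w \<rho> = - \<sigma>"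
        using \<rho> by (cases w) (auto simp: lin_roots simp del: lin.simps(2-))
      moreover have "\<exists>k. awg_map m (\<rho>, of_int (- n)) = (lin w \<rho>, of_int k)"
        using \<rho> unfolding m by (auto simp only: awg_map_roots)
      ultimately show thesis using that by metis
    qed
    ultimately show ?thesis
      using neg[of "- n"] mem_uminus_aff_pos_roots[OF \<sigma>(1), of k] mem_uminus_aff_pos_roots[OF \<sigma>(1), of "- k"]
      by (elim disjE) auto
  qed
  then show "(- \<rho>, of_int n) \<in> inversions m \<longleftrightarrow> 1 \<le> n \<and> n \<le> e"
    unfolding mem_inversions using mem_aff_pos_roots_int[OF \<rho>] by simp
qed

text \<open>\<open>tw_B\<close> consists of the rays of the positive finite roots, so only negative
  Shi coordinates contribute, each by its absolute value.\<close>

lemma card_inversions_tw_B: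
  "int (card (inversions m \<inter> tw_B)) = max 0 (- shi_a m) + max 0 (- shi_b m) + max 0 (- shi_t m)"
proof -
  define I where "I \<rho> e = (\<lambda>n. (\<rho>, of_int n :: real)) ` {0..<- e}" for \<rho> :: 'a and e :: int
  have fin: "finite (I \<rho> e)" and card: "int (card (I \<rho> e)) = max 0 (- e)" for \<rho> e
    unfolding I_def by (simp_all add: card_image inj_on_def)
  have "\<gamma> \<in> inversions m \<inter> tw_B \<longleftrightarrow> \<gamma> \<in> I \<alpha> (shi_a m) \<union> I \<beta> (shi_b m) \<union> I (\<alpha> + \<beta>) (shi_t m)" for \<gamma>
  proof -
    obtain \<rho> r where \<gamma>: "\<gamma> = (\<rho>, r)" by (cases \<gamma>)
    have "(\<rho>, r) \<in> inversions m \<inter> tw_B \<longleftrightarrow> (\<exists>e. (\<rho>, e) \<in> {(\<alpha>, shi_a m), (\<beta>, shi_b m), (\<alpha> + \<beta>, shi_t m)} \<and> (\<rho>, r) \<in> I \<rho> e)"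
    proof
      assume "(\<rho>, r) \<in> inversions m \<inter> tw_B"
      then obtain n where n: "\<rho> \<in> {\<alpha>, \<beta>, \<alpha> + \<beta>}" "r = of_int (int n)" "(\<rho>, r) \<in> inversions m"
        unfolding Int_iff mem_tw_B by auto
      then obtain e where e: "(\<rho>, e) \<in> {(\<alpha>, shi_a m), (\<beta>, shi_b m), (\<alpha> + \<beta>, shi_t m)}" by auto
      then have "int n < - e"
        using n(2,3) inversions_int_iff(1)[OF e, of "int n"] by simp
      then show "\<exists>e. (\<rho>, e) \<in> {(\<alpha>, shi_a m), (\<beta>, shi_b m), (\<alpha> + \<beta>, shi_t m)} \<and> (\<rho>, r) \<in> I \<rho> e"
        using e unfolding I_def n(2) by (intro exI[of _ e] conjI image_eqI[of _ _ "int n"]) auto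
    next
      assume "\<exists>e. (\<rho>, e) \<in> {(\<alpha>, shi_a m), (\<beta>, shi_b m), (\<alpha> + \<beta>, shi_t m)} \<and> (\<rho>, r) \<in> I \<rho> e"
      then obtain e where e: "(\<rho>, e) \<in> {(\<alpha>, shi_a m), (\<beta>, shi_b m), (\<alpha> + \<beta>, shi_t m)}"
        and "(\<rho>, r) \<in> I \<rho> e" by blast
      then obtain n where n: "0 \<le> n" "n < - e" "r = of_int n"
        unfolding I_def by auto
      have "(\<rho>, r) \<in> inversions m" "\<rho> \<in> {\<alpha>, \<beta>, \<alpha> + \<beta>}"
        using inversions_int_iff(1)[OF e, of n] n e by auto
      moreover have "r = real (nat n)" using n by simp
      ultimately show "(\<rho>, r) \<in> inversions m \<inter> tw_B"
        unfolding Int_iff mem_tw_B by blast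
    qed
    also have "\<dots> \<longleftrightarrow> (\<rho>, r) \<in> I \<alpha> (shi_a m) \<union> I \<beta> (shi_b m) \<union> I (\<alpha> + \<beta>) (shi_t m)"
      unfolding I_def by auto
    finally show ?thesis unfolding \<gamma> .
  qed
  then have "inversions m \<inter> tw_B = I \<alpha> (shi_a m) \<union> I \<beta> (shi_b m) \<union> I (\<alpha> + \<beta>) (shi_t m)" by blast
  moreover have "I \<alpha> (shi_a m) \<inter> I \<beta> (shi_b m) = {}" "(I \<alpha> (shi_a m) \<union> I \<beta> (shi_b m)) \<inter> I (\<alpha> + \<beta>) (shi_t m) = {}"
    using distinct_Phi unfolding I_def by auto
  ultimately show ?thesis
    using fin by (simp add: card_Un_disjoint card)
qed

text \<open>For each coordinate k, its absolute value minus twice max(0, -k) is k, so the twisted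
  length is the signed sum.\<close>

lemma tw_len_awg_map: "tw_len \<alpha> \<beta> tw_B (awg_map m) = level m"
  using card_inversions_tw_B[of m, unfolded inversions_def]
  unfolding tw_len_def cox_len_awg_map shi_len_def level_def by simp

lemma tw_step_iff:
  "(\<exists>\<gamma>\<in>aff_roots \<alpha> \<beta>. y = aff_reflection \<gamma> \<circ> awg_map m \<and> tw_len \<alpha> \<beta> tw_B y = tw_len \<alpha> \<beta> tw_B (awg_map m) + 1) \<longleftrightarrow>
    (\<exists>m'. y = awg_map m' \<and> awg_step m m')"
proof -
  have "(\<exists>\<gamma>\<in>aff_roots \<alpha> \<beta>. y = aff_reflection \<gamma> \<circ> awg_map m \<and> P y) \<longleftrightarrow>
      (\<exists>r\<in>refl_model. y = awg_map (awg_mult r m) \<and> P y)" for P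
  proof -
    have "(\<exists>\<gamma>\<in>aff_roots \<alpha> \<beta>. y = aff_reflection \<gamma> \<circ> awg_map m \<and> P y) \<longleftrightarrow>
        (\<exists>f\<in>aff_reflection ` aff_roots \<alpha> \<beta>. y = f \<circ> awg_map m \<and> P y)"
      by blast
    then show ?thesis
      unfolding aff_reflection_image awg_map_mult by blast
  qed
  from this[of "\<lambda>z. tw_len \<alpha> \<beta> tw_B z = tw_len \<alpha> \<beta> tw_B (awg_map m) + 1"] show ?thesis
    unfolding awg_step_def by (metis tw_len_awg_map)
qed

lemma tw_le_awg_map: "tw_le \<alpha> \<beta> tw_B (awg_map m) y \<longleftrightarrow> (\<exists>m'. y = awg_map m' \<and> cone_le m m')"
proof
  assume "tw_le \<alpha> \<beta> tw_B (awg_map m) y"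
  then have "\<exists>m'. y = awg_map m' \<and> awg_step\<^sup>*\<^sup>* m m'"
    unfolding tw_le_def
  proof induction
    case (step y z)
    then obtain m' where m': "y = awg_map m'" "awg_step\<^sup>*\<^sup>* m m'" by blast
    obtain m'' where "z = awg_map m''" "awg_step m' m''"
      using step.hyps(2) unfolding m'(1) tw_step_iff by blast
    then show ?case using rtranclp.rtrancl_into_rtrancl[OF m'(2)] by blast
  qed blast
  then show "\<exists>m'. y = awg_map m' \<and> cone_le m m'"
    by (simp add: rtranclp_awg_step_iff)
next
  assume "\<exists>m'. y = awg_map m' \<and> cone_le m m'"
  then obtain m' where m': "y = awg_map m'" "awg_step\<^sup>*\<^sup>* m m'"
    unfolding rtranclp_awg_step_iff by blast
  show "tw_le \<alpha> \<beta> tw_B (awg_map m) y"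
    unfolding tw_le_def m'(1) using m'(2)
  proof induction
    case (step k l)
    then show ?case
      using tw_step_iff[of "awg_map l" k] by (intro rtranclp.rtrancl_into_rtrancl[OF step.IH]) blast
  qed blast
qed

lemma tw_le_awg_map_iff: "tw_le \<alpha> \<beta> tw_B (awg_map m) (awg_map m') \<longleftrightarrow> cone_le m m'"
  unfolding tw_le_awg_map using injD[OF inj_awg_map] by blast

lemma is_tw_interval_awg_map:
  "is_tw_interval \<alpha> \<beta> tw_B n (awg_map m) (awg_map m') \<longleftrightarrow> cone_le m m' \<and> level m' = level m + n"
  unfolding is_tw_interval_def aff_Weyl_eq tw_le_awg_map_iff tw_len_awg_map by auto

lemma is_tw_intervalE:
  assumes "is_tw_interval \<alpha> \<beta> tw_B n x y"
  obtains m m' where "x = awg_map m" "y = awg_map m'" "cone_le m m'" "level m' = level m + n"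
proof -
  obtain m m' where "x = awg_map m" "y = awg_map m'"
    using assms unfolding is_tw_interval_def aff_Weyl_eq by blast
  then show thesis using assms is_tw_interval_awg_map that by blast
qed

lemma tw_interval_awg_map:
  "tw_interval \<alpha> \<beta> tw_B (awg_map m) (awg_map m') = awg_map ` cone_interval m m'"
  unfolding tw_interval_def aff_Weyl_eq cone_interval_def by (auto simp: tw_le_awg_map_iff)

lemma spherical_awg_map: "spherical \<alpha> \<beta> tw_B (awg_map m) (awg_map m') \<longleftrightarrow> cone_spherical m m'"
proof -
  have card: "card (tw_interval \<alpha> \<beta> tw_B (awg_map k) (awg_map k')) = 4 \<longleftrightarrow> \<bar>column k' - column k\<bar> \<noteq> 3"
    if k: "cone_le k k'" "level k' = level k + 2" for k k'
    unfolding tw_interval_awg_map card_image[OF inj_on_subset[OF inj_awg_map subset_UNIV]]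
    using k by (rule cone_interval_length_2) simp_all
  have "spherical \<alpha> \<beta> tw_B (awg_map m) (awg_map m') \<longleftrightarrow>
     (\<forall>k\<in>cone_interval m m'. \<forall>k'\<in>cone_interval m m'. is_tw_interval \<alpha> \<beta> tw_B 2 (awg_map k) (awg_map k') \<longrightarrow>
        card (tw_interval \<alpha> \<beta> tw_B (awg_map k) (awg_map k')) = 4)"
    unfolding spherical_def tw_interval_awg_map[of m m'] by blast
  also have "\<dots> \<longleftrightarrow>
     (\<forall>k\<in>cone_interval m m'. \<forall>k'\<in>cone_interval m m'. cone_le k k' \<and> level k' = level k + 2 \<longrightarrow> \<bar>column k' - column k\<bar> \<noteq> 3)"
    unfolding is_tw_interval_awg_map using card by blast
  also have "\<dots> \<longleftrightarrow> cone_spherical m m'"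
    unfolding cone_spherical_def cone_interval_def using cone_le_trans by blast
  finally show ?thesis .
qed

section \<open>Prefixes and cosets\<close>

lemma initial_prod_Suc: "initial_prod \<omega> (Suc n) = initial_prod \<omega> n \<circ> \<omega> n"
proof -
  have "foldr (\<circ>) fs f = foldr (\<circ>) fs id \<circ> f" for fs :: "('b \<Rightarrow> 'b) list" and f
    by (induction fs) (simp_all add: comp_assoc)
  then show ?thesis unfolding initial_prod_def word_prod_def by simp
qed

text \<open>\<open>e\<close> is 1 for \<open>\<x>\<close> and -1 for \<open>\<y>\<close>. The
  initial products are inverses of column bases, with which a prefix is compared ray by ray through
  its inversions.\<close>

lemma prefixes:
  assumes e: "e = 1 \<or> e = - 1" and \<omega>: "\<And>n. \<omega> n = awg_map (ms n)" "\<And>n. ms n \<in> simple_model"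
    "\<And>n. awg_mult (ms n) (column_base (e * int n)) = column_base (e * int (Suc n))"
  shows "inf_reduced \<alpha> \<beta> \<omega>"
    and "is_prefix \<alpha> \<beta> p \<omega> \<and> cox_len \<alpha> \<beta> p = n \<longleftrightarrow> p = inv_into UNIV (awg_map (column_base (e * int n)))"
proof -
  have prod: "initial_prod \<omega> n = inv_into UNIV (awg_map (column_base (e * int n)))" for n
  proof (induction n)
    case 0
    have "column_base 0 = (W_1, 0, 0)" by (metis column_base(4) abs_zero shi_len_eq_0)
    then show ?case by (simp add: initial_prod_def word_prod_simps awg_map_one)
  next
    case (Suc n)
    have "inv_into UNIV (awg_map (column_base (e * int (Suc n)))) =
        inv_into UNIV (awg_map (column_base (e * int n))) \<circ> inv_into UNIV (awg_map (ms n))"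
      unfolding \<omega>(3)[symmetric] awg_map_mult by (intro o_inv_distrib awg_map_inv)
    also have "inv_into UNIV (awg_map (ms n)) = \<omega> n"
      unfolding awg_map_inv \<omega>(1) simple_model_inv[OF \<omega>(2)] ..
    finally show ?case unfolding initial_prod_Suc Suc.IH by simp
  qed
  have len: "int (cox_len \<alpha> \<beta> (inv_into UNIV (awg_map m))) = shi_len m" for m
    unfolding awg_map_inv cox_len_awg_map shi_len_inv ..
  have "int (cox_len \<alpha> \<beta> (initial_prod \<omega> n)) = int n" for n
    unfolding prod len column_base using e by auto
  then show "inf_reduced \<alpha> \<beta> \<omega>"
    unfolding inf_reduced_def simple_refls_eq using \<omega>(1,2) by auto
  have prefix: "is_prefix \<alpha> \<beta> (inv_into UNIV (awg_map m)) \<omega> \<longleftrightarrow> 0 \<le> e * column m \<and> shi_t m = 0" for m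
  proof
    assume "is_prefix \<alpha> \<beta> (inv_into UNIV (awg_map m)) \<omega>"
    then have sub: "\<exists>n. \<gamma> \<in> inversions (column_base (e * int n))" if "\<gamma> \<in> inversions m" for \<gamma>
      using that unfolding is_prefix_def inversions_def prod by blast
    define P where "P k = (\<exists>n. column_base (e * int n) = k)" for k
    have P: "shi_t k = 0" "e * shi_a k \<ge> 0" "e * shi_b k \<le> 0" if "P k" for k
      using that e column_base_shi column_base(2) unfolding P_def by auto
    have sub: "\<exists>k. P k \<and> (\<rho>, of_int n) \<in> inversions k" if "(\<rho>, of_int n) \<in> inversions m" for \<rho> n
      using sub[OF that] unfolding P_def by blast
    \<comment> \<open>On each ray the inversions form an initial segment, so containment in the
      union bounds every Shi coordinate of \<open>m\<close> by that of some column base; the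
      comparison with 0 covers empty segments.\<close>
    have bounds: "\<exists>k. P k \<and> f m \<le> max 0 (f k)" "\<exists>k. P k \<and> min 0 (f k) \<le> f m"
      if f: "\<And>k. (\<rho>, f k) \<in> {(\<alpha>, shi_a k), (\<beta>, shi_b k), (\<alpha> + \<beta>, shi_t k)}" for \<rho> f
    proof -
      have P0: "P (column_base (e * int 0))" unfolding P_def by blast
      show "\<exists>k. P k \<and> f m \<le> max 0 (f k)"
      proof (cases "f m \<le> 0")
        case True
        then show ?thesis using P0 by (intro exI[of _ "column_base (e * int 0)"]) simp
      next
        case False
        then obtain k where "P k" "(- \<rho>, of_int (f m)) \<in> inversions k"
          using sub[of "- \<rho>" "f m"] inversions_int_iff(2)[OF f, of "f m" m] by auto
        then show ?thesis
          using inversions_int_iff(2)[OF f, of "f m" k] by (intro exI[of _ k]) simp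
      qed
      show "\<exists>k. P k \<and> min 0 (f k) \<le> f m"
      proof (cases "f m \<ge> 0")
        case True
        then show ?thesis using P0 by (intro exI[of _ "column_base (e * int 0)"]) simp
      next
        case False
        \<comment> \<open>The last inversion on the ray of \<rho>; its index is
          \<open>- f m - 1\<close> because indices start at 0.\<close>
        then obtain k where "P k" "(\<rho>, of_int (- f m - 1)) \<in> inversions k"
          using sub[of \<rho> "- f m - 1"] inversions_int_iff(1)[OF f, of "- f m - 1" m] by auto
        then show ?thesis
          using inversions_int_iff(1)[OF f, of "- f m - 1" k] by (intro exI[of _ k]) simp
      qed
    qed
    have "shi_t m \<le> 0" "0 \<le> shi_t m"
      using bounds[of "\<alpha> + \<beta>" shi_t] P(1) by (metis insertCI max.idem, metis insertCI min.idem)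
    then have "shi_t m = 0" by simp
    moreover have "0 \<le> e * shi_a m"
    proof -
      obtain k k' where "P k" "P k'" "shi_a m \<le> max 0 (shi_a k)" "min 0 (shi_a k') \<le> shi_a m"
        using bounds[of \<alpha> shi_a] by (metis insertCI)
      then show ?thesis
        using e P(2)[of k] P(2)[of k'] by (elim disjE) simp_all
    qed
    moreover have "e * shi_b m \<le> 0"
    proof -
      obtain k k' where "P k" "P k'" "shi_b m \<le> max 0 (shi_b k)" "min 0 (shi_b k') \<le> shi_b m"
        using bounds[of \<beta> shi_b] by (metis insertCI)
      then show ?thesis
        using e P(3)[of k] P(3)[of k'] by (elim disjE) simp_all
    qed
    ultimately show "0 \<le> e * column m \<and> shi_t m = 0"
      unfolding column_def by (simp add: algebra_simps)
  next
    \<comment> \<open>Such an \<open>m\<close> is a column base on the side chosen by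
      \<open>e\<close>, so its inverse is itself an initial product.\<close>
    assume m: "0 \<le> e * column m \<and> shi_t m = 0"
    then have "column m = e * int (nat (e * column m))" using e by auto
    then have "m = column_base (e * int (nat (e * column m)))"
      using m column_base_iff by metis
    then have "inv_into UNIV (awg_map m) = initial_prod \<omega> (nat (e * column m))"
      unfolding prod by simp
    moreover have "inv_into UNIV (awg_map m) \<in> aff_Weyl \<alpha> \<beta>"
      unfolding awg_map_inv aff_Weyl_eq by simp
    ultimately show "is_prefix \<alpha> \<beta> (inv_into UNIV (awg_map m)) \<omega>"
      unfolding is_prefix_def by auto
  qed
  show "is_prefix \<alpha> \<beta> p \<omega> \<and> cox_len \<alpha> \<beta> p = n \<longleftrightarrow> p = inv_into UNIV (awg_map (column_base (e * int n)))"
  proof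
    assume p: "is_prefix \<alpha> \<beta> p \<omega> \<and> cox_len \<alpha> \<beta> p = n"
    then obtain k where "p = awg_map k" unfolding is_prefix_def aff_Weyl_eq by blast
    then have k: "p = inv_into UNIV (awg_map (awg_inv k))"
      by (metis awg_map_inv inv_inv_eq)
    then have m: "0 \<le> e * column (awg_inv k)" "shi_t (awg_inv k) = 0" "shi_len (awg_inv k) = int n"
      using p prefix[of "awg_inv k"] len[of "awg_inv k"] unfolding k by simp_all
    then have "column (awg_inv k) = e * int n"
      using shi_len_column(1)[of "awg_inv k"] e by auto
    then show "p = inv_into UNIV (awg_map (column_base (e * int n)))"
      using k m(2) column_base_iff by metis
  next
    assume p: "p = inv_into UNIV (awg_map (column_base (e * int n)))"
    show "is_prefix \<alpha> \<beta> p \<omega> \<and> cox_len \<alpha> \<beta> p = n"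
      using prefix[of "column_base (e * int n)"] len[of "column_base (e * int n)"] e
      unfolding p column_base by auto
  qed
qed

lemma coset_eq:
  "(\<circ>) (awg_map m) ` awg_map ` ({W_1, W_aba} \<times> range (\<lambda>n. (n, n))) = awg_map ` {m'. column m' = column m}"
proof -
  have "(\<circ>) (awg_map m) ` awg_map ` ({W_1, W_aba} \<times> range (\<lambda>n. (n, n))) =
      awg_map ` awg_mult m ` ({W_1, W_aba} \<times> range (\<lambda>n. (n, n)))"
    unfolding image_image awg_map_mult ..
  moreover have "awg_mult m ` ({W_1, W_aba} \<times> range (\<lambda>n. (n, n))) = {m'. column m' = column m}"
    unfolding same_column_iff by blast
  ultimately show ?thesis by simp
qed

text \<open>In column \<open>j\<close> only \<open>column_base j\<close> has vanishing
  \<open>shi_t\<close>, and by \<open>shi_len_column\<close> all other elements are longer.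
  Membership in the column forces i = j.\<close>

lemma unique_minimal_coset_iff:
  assumes "y \<in> awg_map ` {m'. column m' = j}"
  shows "unique_minimal \<alpha> \<beta> y (awg_map ` {m'. column m' = j}) \<longleftrightarrow> (\<exists>i. y = awg_map (column_base i))"
proof -
  obtain k where k: "y = awg_map k" "column k = j" using assms by blast
  have less: "cox_len \<alpha> \<beta> (awg_map (column_base j)) < cox_len \<alpha> \<beta> (awg_map l)"
    if "column l = j" "l \<noteq> column_base j" for l
  proof -
    have "shi_len (column_base j) < shi_len l"
      using that shi_len_column(2)[of l] column_base(4) column_base_iff by metis
    then show ?thesis unfolding cox_len_awg_map[symmetric] by simp
  qed
  show ?thesis
  proof
    assume "\<exists>i. y = awg_map (column_base i)"
    then obtain i where i: "y = awg_map (column_base i)" by blast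
    then have "k = column_base i" using k(1) injD[OF inj_awg_map] by simp
    then have y: "y = awg_map (column_base j)" using i k(2) column_base(1) by simp
    show "unique_minimal \<alpha> \<beta> y (awg_map ` {m'. column m' = j})"
      unfolding unique_minimal_def
    proof (intro conjI ballI impI assms)
      fix z assume "z \<in> awg_map ` {m'. column m' = j}" and zy: "z \<noteq> y"
      then obtain l where l: "z = awg_map l" "column l = j" by blast
      then have "l \<noteq> column_base j" using zy y by metis
      with l show "cox_len \<alpha> \<beta> y < cox_len \<alpha> \<beta> z"
        unfolding y using less by simp
    qed
  next
    assume min: "unique_minimal \<alpha> \<beta> y (awg_map ` {m'. column m' = j})"
    have "awg_map (column_base j) \<in> awg_map ` {m'. column m' = j}"
      using column_base(1) by blast
    then have "awg_map (column_base j) = y"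
      using min less k unfolding unique_minimal_def by (metis less_asym)
    then show "\<exists>i. y = awg_map (column_base i)" by metis
  qed
qed

lemma translation_power: "awg_map (W_1, c, c) ^^ k = awg_map (W_1, int k * c, int k * c)"
  by (induction k) (simp_all add: awg_map_one awg_map_mult[symmetric] algebra_simps)

section \<open>Intervals and automorphisms\<close>

lemma comp_awg_map_eq_iff:
  "awg_map k = awg_map r \<circ> awg_map r' \<circ> awg_map m \<longleftrightarrow> k = awg_mult r (awg_mult r' m)"
proof -
  have "awg_map r \<circ> awg_map r' \<circ> awg_map m = awg_map (awg_mult r (awg_mult r' m))"
    unfolding awg_map_mult comp_assoc ..
  then show ?thesis by (simp only: inj_eq[OF inj_awg_map])
qed

lemma simple_pair_iff:
  "(\<exists>s\<in>awg_map ` simple_model. \<exists>s'\<in>awg_map ` simple_model. s \<noteq> s' \<and> awg_map m' = s \<circ> s' \<circ> awg_map m) \<longleftrightarrow>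
    (\<exists>s\<in>simple_model. \<exists>s'\<in>simple_model. s \<noteq> s' \<and> m' = awg_mult s (awg_mult s' m))"
  unfolding bex_simps comp_awg_map_eq_iff inj_eq[OF inj_awg_map] ..

lemma double_refl_iff:
  "(\<exists>\<gamma>\<in>{(\<alpha>, 0), (\<beta>, 0), (\<alpha> + \<beta>, 0), \<delta> - (\<alpha>, 0), \<delta> - (\<beta>, 0), \<delta> - (\<alpha>, 0) - (\<beta>, 0)}.
      awg_map m' = aff_reflection (\<delta> - \<gamma>) \<circ> aff_reflection \<gamma> \<circ> awg_map m) \<longleftrightarrow>
    (\<exists>(r, r')\<in>double_refl_model. m' = awg_mult r (awg_mult r' m))"
proof -
  have "\<delta> - (\<delta> - (\<alpha>, 0) - (\<beta>, 0)) = (\<alpha> + \<beta>, 0)" "\<delta> - (\<delta> - \<gamma>) = \<gamma>" for \<gamma> :: "'a \<times> real"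
    by (simp_all add: \<delta>_def)
  then show ?thesis
    unfolding double_refl_model_def bex_simps prod.case
    by (simp only: simple_reflection_awg_map comp_awg_map_eq_iff)
qed

lemma length_2_intervals:
  assumes "is_tw_interval \<alpha> \<beta> tw_B 2 x y"
  defines "P \<equiv> \<exists>s\<in>awg_map ` simple_model. \<exists>s'\<in>awg_map ` simple_model. s \<noteq> s' \<and> y = s \<circ> s' \<circ> x"
    and "Q \<equiv> \<exists>\<gamma>\<in>{(\<alpha>, 0), (\<beta>, 0), (\<alpha> + \<beta>, 0), \<delta> - (\<alpha>, 0), \<delta> - (\<beta>, 0), \<delta> - (\<alpha>, 0) - (\<beta>, 0)}.
      y = aff_reflection (\<delta> - \<gamma>) \<circ> aff_reflection \<gamma> \<circ> x"
  shows "P \<or> Q" "P \<Longrightarrow> spherical \<alpha> \<beta> tw_B x y" "Q \<Longrightarrow> \<not> spherical \<alpha> \<beta> tw_B x y"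
proof -
  obtain m m' where m: "x = awg_map m" "y = awg_map m'" "cone_le m m'" "level m' = level m + 2"
    using assms(1) by (rule is_tw_intervalE)
  have P: "P \<longleftrightarrow> (\<exists>s\<in>simple_model. \<exists>s'\<in>simple_model. s \<noteq> s' \<and> m' = awg_mult s (awg_mult s' m))"
    unfolding P_def m(1,2) by (rule simple_pair_iff)
  have Q: "Q \<longleftrightarrow> (\<exists>(r, r')\<in>double_refl_model. m' = awg_mult r (awg_mult r' m))"
    unfolding Q_def m(1,2) by (rule double_refl_iff)
  have sph: "spherical \<alpha> \<beta> tw_B x y \<longleftrightarrow> \<bar>column m' - column m\<bar> = 1"
    unfolding m(1,2) spherical_awg_map using cone_spherical_length_2[OF m(3,4)] .
  show "P \<Longrightarrow> spherical \<alpha> \<beta> tw_B x y"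
    unfolding P sph using simple_pair_column m(4) by blast
  show "Q \<Longrightarrow> \<not> spherical \<alpha> \<beta> tw_B x y"
    unfolding Q sph using double_refl_column m(4) by fastforce
  show "P \<or> Q"
    using m(3,4)
  proof (rule cone_interval_length_2)
    assume "\<bar>column m' - column m\<bar> = 1"
    then show ?thesis using simple_pair_exists[OF _ m(4)] unfolding P by blast
  next
    assume "\<bar>column m' - column m\<bar> = 3"
    then show ?thesis using double_refl_exists[OF _ m(4)] unfolding Q by blast
  qed
qed

lemma left_coset_transl_group: "awg_map m \<in> (\<circ>) (awg_map (w, 0, 0)) ` transl_group \<alpha> \<beta> \<longleftrightarrow> (\<exists>a b. m = (w, a, b))"
proof -
  have "awg_mult (w, 0, 0) (W_1, a, b) = (w, a, b)" for a b by (cases w) simp_all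
  then have "(\<circ>) (awg_map (w, 0, 0)) ` transl_group \<alpha> \<beta> = awg_map ` ({w} \<times> UNIV)"
    unfolding transl_group_eq image_image awg_map_mult[symmetric] by (auto simp: image_iff inj_eq[OF inj_awg_map] simp del: awg_mult.simps)
  then show ?thesis
    by (auto simp: inj_image_mem_iff[OF inj_awg_map])
qed

text \<open>At displacement 0 the cone relation follows from the level difference, so the order is
  recovered from the coordinates alone.\<close>

lemma length_3_intervals:
  "is_tw_interval \<alpha> \<beta> tw_B 3 (awg_map m) (awg_map m') \<and> spherical \<alpha> \<beta> tw_B (awg_map m) (awg_map m') \<longleftrightarrow>
    level m' = level m + 3 \<and> column m' = column m \<and> odd (level m)"
proof -
  have "cone_le m m'" if "level m' = level m + 3" "column m' = column m"
    using that unfolding cone_le_def cone_width_def by simp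
  then show ?thesis
    unfolding is_tw_interval_awg_map spherical_awg_map using cone_spherical_length_3 by blast
qed

lemma not_spherical_length_gt_3:
  assumes "is_tw_interval \<alpha> \<beta> tw_B n x y" "n > 3"
  shows "\<not> spherical \<alpha> \<beta> tw_B x y"
  using assms(1) by (rule is_tw_intervalE) (use assms(2) in \<open>simp add: spherical_awg_map not_cone_spherical_length_gt_3\<close>)

lemma tw_le_automorphism:
  assumes "x \<in> range awg_map" "y \<in> range awg_map"
    "even (tw_len \<alpha> \<beta> tw_B x) \<longleftrightarrow> even (tw_len \<alpha> \<beta> tw_B y)"
  shows "\<exists>\<phi>. bij_betw \<phi> (range awg_map) (range awg_map) \<and>
    (\<forall>a\<in>range awg_map. \<forall>b\<in>range awg_map. tw_le \<alpha> \<beta> tw_B a b \<longleftrightarrow> tw_le \<alpha> \<beta> tw_B (\<phi> a) (\<phi> b)) \<and> \<phi> x = y"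
proof -
  obtain m m' where m: "x = awg_map m" "y = awg_map m'" using assms(1,2) by blast
  obtain f where f: "bij f" "\<And>k k'. cone_le (f k) (f k') \<longleftrightarrow> cone_le k k'" "f m = m'"
    using assms(3) cone_automorphism unfolding m tw_len_awg_map by blast
  define \<phi> where "\<phi> = awg_map \<circ> f \<circ> inv_into UNIV awg_map"
  have \<phi>: "\<phi> (awg_map k) = awg_map (f k)" for k
    unfolding \<phi>_def by (simp add: inj_awg_map)
  have "bij_betw \<phi> (range awg_map) (range awg_map)"
    unfolding \<phi>_def comp_assoc
    by (rule bij_betw_trans[of _ _ UNIV], rule bij_betw_trans[of _ _ UNIV])
      (use inj_awg_map f(1) in \<open>auto intro: bij_betw_inv_into inj_imp_bij_betw_inv simp: bij_betw_def[of awg_map]\<close>)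
  then show ?thesis
    using \<phi> f m by (intro exI[of _ \<phi>]) (auto simp: tw_le_awg_map_iff)
qed

end

theorem proposition6p2:
  fixes \<alpha> \<beta> :: "'a::euclidean_space"
    and s\<^sub>\<alpha> s\<^sub>\<beta> s\<^sub>0 u v :: "'a \<times> real \<Rightarrow> 'a \<times> real"
    and W T U :: "('a \<times> real \<Rightarrow> 'a \<times> real) set"
    and B :: "('a \<times> real) set"
    and l\<^sub>B :: "('a \<times> real \<Rightarrow> 'a \<times> real) \<Rightarrow> int"
    and \<x> \<y> :: "nat \<Rightarrow> 'a \<times> real \<Rightarrow> 'a \<times> real"
    and w :: "int \<Rightarrow> 'a \<times> real \<Rightarrow> 'a \<times> real"
  assumes plane: "DIM('a) = 2"
    and A2: "A2_simple_roots \<alpha> \<beta>"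
    and s\<^sub>\<alpha>_def: "s\<^sub>\<alpha> = aff_reflection (\<alpha>, 0)"
    and s\<^sub>\<beta>_def: "s\<^sub>\<beta> = aff_reflection (\<beta>, 0)"
    and s\<^sub>0_def: "s\<^sub>0 = aff_reflection (\<delta> - (\<alpha>, 0) - (\<beta>, 0))"
    and W_def: "W = aff_Weyl \<alpha> \<beta>"
    and T_def: "T = transl_group \<alpha> \<beta>"
    and B_def: "B = aff_hat \<alpha> \<beta> {\<alpha>, \<alpha> + \<beta>, \<beta>}"
    and l\<^sub>B_def: "l\<^sub>B = tw_len \<alpha> \<beta> B"
    and x_def: "\<x> = periodic_word [s\<^sub>\<beta>, s\<^sub>0, s\<^sub>\<alpha>]"
    and y_def: "\<y> = periodic_word [s\<^sub>\<alpha>, s\<^sub>0, s\<^sub>\<beta>]"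
    and w_def: "w = (\<lambda>i. if i \<ge> 0 then the_prefix \<alpha> \<beta> \<x> (nat i) else the_prefix \<alpha> \<beta> \<y> (nat (- i)))"
    and v_def: "v = s\<^sub>0"
    and u_def: "u = s\<^sub>\<alpha> \<circ> s\<^sub>\<beta> \<circ> s\<^sub>\<alpha>"
    and U_def: "U = generate (BijGroup UNIV) {v, u}"
  shows
   "
    \<comment> \<open>(1)(a)\<close>
     (\<forall>x y. is_tw_interval \<alpha> \<beta> B 2 x y \<longrightarrow>
        (\<exists>s\<^sub>1\<in>{s\<^sub>\<alpha>, s\<^sub>\<beta>, s\<^sub>0}. \<exists>s\<^sub>2\<in>{s\<^sub>\<alpha>, s\<^sub>\<beta>, s\<^sub>0}. s\<^sub>1 \<noteq> s\<^sub>2 \<and> y = s\<^sub>1 \<circ> s\<^sub>2 \<circ> x) \<or>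
        (\<exists>\<gamma>\<in>{(\<alpha>, 0), (\<beta>, 0), (\<alpha> + \<beta>, 0), \<delta> - (\<alpha>, 0), \<delta> - (\<beta>, 0), \<delta> - (\<alpha>, 0) - (\<beta>, 0)}.
           y = aff_reflection (\<delta> - \<gamma>) \<circ> aff_reflection \<gamma> \<circ> x))
     \<and> (\<forall>x y. is_tw_interval \<alpha> \<beta> B 2 x y \<longrightarrow>
        (\<exists>s\<^sub>1\<in>{s\<^sub>\<alpha>, s\<^sub>\<beta>, s\<^sub>0}. \<exists>s\<^sub>2\<in>{s\<^sub>\<alpha>, s\<^sub>\<beta>, s\<^sub>0}. s\<^sub>1 \<noteq> s\<^sub>2 \<and> y = s\<^sub>1 \<circ> s\<^sub>2 \<circ> x) \<longrightarrow>
        spherical \<alpha> \<beta> B x y)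
     \<and> (\<forall>x y. is_tw_interval \<alpha> \<beta> B 2 x y \<longrightarrow>
        (\<exists>\<gamma>\<in>{(\<alpha>, 0), (\<beta>, 0), (\<alpha> + \<beta>, 0), \<delta> - (\<alpha>, 0), \<delta> - (\<beta>, 0), \<delta> - (\<alpha>, 0) - (\<beta>, 0)}.
           y = aff_reflection (\<delta> - \<gamma>) \<circ> aff_reflection \<gamma> \<circ> x) \<longrightarrow>
        \<not> spherical \<alpha> \<beta> B x y)
    \<comment> \<open>(1)(b)\<close>
     \<and> (\<forall>x\<in>W. \<forall>y\<in>W. is_tw_interval \<alpha> \<beta> B 3 x y \<and> spherical \<alpha> \<beta> B x y \<longleftrightarrow>
        (y = s\<^sub>\<alpha> \<circ> s\<^sub>\<beta> \<circ> s\<^sub>\<alpha> \<circ> x \<and> x \<in> (\<circ>) (s\<^sub>\<alpha> \<circ> s\<^sub>\<beta> \<circ> s\<^sub>\<alpha>) ` T) \<or>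
        (y = s\<^sub>0 \<circ> s\<^sub>\<beta> \<circ> s\<^sub>0 \<circ> x \<and> x \<in> (\<circ>) s\<^sub>\<beta> ` T) \<or>
        (y = s\<^sub>\<alpha> \<circ> s\<^sub>0 \<circ> s\<^sub>\<alpha> \<circ> x \<and> x \<in> (\<circ>) s\<^sub>\<alpha> ` T))
    \<comment> \<open>(1)(c)\<close>
     \<and> (\<forall>n x y. n > 3 \<and> is_tw_interval \<alpha> \<beta> B n x y \<longrightarrow> \<not> spherical \<alpha> \<beta> B x y)
    \<comment> \<open>(2): the setup is well posed\<close>
     \<and> (inf_reduced \<alpha> \<beta> \<x>)
     \<and> (inf_reduced \<alpha> \<beta> \<y>)
     \<and> (\<forall>n. \<exists>!p. is_prefix \<alpha> \<beta> p \<x> \<and> cox_len \<alpha> \<beta> p = n)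
     \<and> (\<forall>n. \<exists>!p. is_prefix \<alpha> \<beta> p \<y> \<and> cox_len \<alpha> \<beta> p = n)
     \<and> (u \<circ> u = id)
     \<and> (v \<circ> v = id)
     \<and> (\<forall>k>0. (u \<circ> v) ^^ k \<noteq> id)
    \<comment> \<open>(2): minimal coset representatives\<close>
     \<and> (\<forall>x\<in>W. \<forall>y\<in>(\<circ>) x ` U. unique_minimal \<alpha> \<beta> y ((\<circ>) x ` U) \<longleftrightarrow> (\<exists>i. y = inv_into UNIV (w i)))
     \<and> (\<forall>x\<in>W. \<exists>z\<in>U. \<exists>i. x = inv_into UNIV (w i) \<circ> z)
    \<comment> \<open>(2)(a)--(d)\<close>
     \<and> (\<forall>i k. l\<^sub>B (inv_into UNIV (w i) \<circ> u \<circ> (v \<circ> u) ^^ k) = (if even i then - 4 * int k - 3 else - 4 * int k - 2))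
     \<and> (\<forall>i k. l\<^sub>B (inv_into UNIV (w i) \<circ> (v \<circ> u) ^^ k) = (if even i then - 4 * int k else - 4 * int k - 1))
     \<and> (\<forall>i k. l\<^sub>B (inv_into UNIV (w i) \<circ> v \<circ> (u \<circ> v) ^^ k) = (if even i then 4 * int k + 1 else 4 * int k + 2))
     \<and> (\<forall>i k. l\<^sub>B (inv_into UNIV (w i) \<circ> (u \<circ> v) ^^ k) = (if even i then 4 * int k else 4 * int k - 1))
    \<comment> \<open>(3)\<close>
     \<and> (\<forall>x\<in>W. \<forall>y\<in>W. (even (l\<^sub>B x) \<longleftrightarrow> even (l\<^sub>B y)) \<longrightarrow>
        (\<exists>\<phi>. bij_betw \<phi> W W \<and>
             (\<forall>a\<in>W. \<forall>b\<in>W. tw_le \<alpha> \<beta> B a b \<longleftrightarrow> tw_le \<alpha> \<beta> B (\<phi> a) (\<phi> b)) \<and>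
             \<phi> x = y))"
proof -
  interpret A2_plane \<alpha> \<beta> by unfold_locales (rule A2)
  have s: "s\<^sub>\<alpha> = awg_map (W_a, 0, 0)" "s\<^sub>\<beta> = awg_map (W_b, 0, 0)" "s\<^sub>0 = awg_map (W_aba, 1, 1)"
    unfolding s\<^sub>\<alpha>_def s\<^sub>\<beta>_def s\<^sub>0_def by (rule simple_reflection_awg_map)+
  have simples: "{s\<^sub>\<alpha>, s\<^sub>\<beta>, s\<^sub>0} = awg_map ` simple_model"
    unfolding s simple_model_def by simp
  have u: "u = awg_map (W_aba, 0, 0)" and v: "v = awg_map (W_aba, 1, 1)"
    unfolding u_def v_def s awg_map_mult[symmetric] by simp_all
  \<comment> \<open>These are the reflections in \<delta> - \<alpha>, \<delta> - \<beta> and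
    \<alpha> + \<beta>.\<close>
  have triple: "s\<^sub>0 \<circ> s\<^sub>\<beta> \<circ> s\<^sub>0 = awg_map (W_a, 1, 0)" "s\<^sub>\<alpha> \<circ> s\<^sub>0 \<circ> s\<^sub>\<alpha> = awg_map (W_b, 0, 1)"
    "s\<^sub>\<alpha> \<circ> s\<^sub>\<beta> \<circ> s\<^sub>\<alpha> = awg_map (W_aba, 0, 0)"
    unfolding s awg_map_mult[symmetric] by simp_all
  have B: "B = tw_B" unfolding B_def tw_B_def ..
  have lB: "l\<^sub>B (awg_map m) = level m" for m
    unfolding l\<^sub>B_def B by (rule tw_len_awg_map)
  have W: "W = range awg_map" unfolding W_def by (rule aff_Weyl_eq)
  have U: "U = awg_map ` ({W_1, W_aba} \<times> range (\<lambda>n. (n, n)))"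
    unfolding U_def u v by (rule dihedral_eq)
  have uv: "u \<circ> v = awg_map (W_1, 1, 1)" "v \<circ> u = awg_map (W_1, - 1, - 1)" "u \<circ> u = id" "v \<circ> v = id"
    unfolding u v awg_map_mult[symmetric] by (simp_all add: awg_map_one)

  have "\<x> n = map awg_map [(W_b, 0, 0), (W_aba, 1, 1), (W_a, 0, 0)] ! (n mod 3)"
    "\<y> n = map awg_map [(W_a, 0, 0), (W_aba, 1, 1), (W_b, 0, 0)] ! (n mod 3)" for n
    unfolding x_def y_def periodic_word_def s by simp_all
  then have x: "\<x> n = awg_map ([(W_b, 0, 0), (W_aba, 1, 1), (W_a, 0, 0)] ! (n mod 3))"
    and y: "\<y> n = awg_map ([(W_a, 0, 0), (W_aba, 1, 1), (W_b, 0, 0)] ! (n mod 3))" for n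
    by (subst (asm) nth_map, simp, blast)+
  have "[(W_b, 0, 0), (W_aba, 1, 1), (W_a, 0, 0)] ! (n mod 3) \<in> simple_model"
    "[(W_a, 0, 0), (W_aba, 1, 1), (W_b, 0, 0)] ! (n mod 3) \<in> simple_model" for n
  proof -
    have "n mod 3 = 0 \<or> n mod 3 = 1 \<or> n mod 3 = 2" by presburger
    then show "[(W_b, 0, 0), (W_aba, 1, 1), (W_a, 0, 0)] ! (n mod 3) \<in> simple_model"
      "[(W_a, 0, 0), (W_aba, 1, 1), (W_b, 0, 0)] ! (n mod 3) \<in> simple_model"
      unfolding simple_model_def by auto
  qed
  \<comment> \<open>After n letters the column is n or -n, so the letter of index n mod 3 is the one
    that moves on by one column.\<close>
  note prefix_x = prefixes[of 1, OF _ x this(1), unfolded mult_1, OF _ awg_mult_column_base(1), simplified]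
    and prefix_y = prefixes[of "- 1", OF _ y this(2), unfolded mult_minus1, OF _ awg_mult_column_base(2), simplified]
  \<comment> \<open>The two words join up: for either sign of \<open>i\<close> the prefix is the
    inverse of the column base.\<close>
  have w: "inv_into UNIV (w i) = awg_map (column_base i)" for i
  proof -
    have "w i = inv_into UNIV (awg_map (column_base i))"
      unfolding w_def the_prefix_def prefix_x(2) prefix_y(2) by simp
    then show ?thesis by (simp only: inv_inv_eq[OF awg_map_inv(1)])
  qed
  have unique: "(\<forall>n. \<exists>!p. is_prefix \<alpha> \<beta> p \<x> \<and> cox_len \<alpha> \<beta> p = n)" "(\<forall>n. \<exists>!p. is_prefix \<alpha> \<beta> p \<y> \<and> cox_len \<alpha> \<beta> p = n)"
    unfolding prefix_x(2) prefix_y(2) by simp_all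

  have part_1b: "\<forall>x\<in>W. \<forall>y\<in>W. is_tw_interval \<alpha> \<beta> B 3 x y \<and> spherical \<alpha> \<beta> B x y \<longleftrightarrow>
        (y = s\<^sub>\<alpha> \<circ> s\<^sub>\<beta> \<circ> s\<^sub>\<alpha> \<circ> x \<and> x \<in> (\<circ>) (s\<^sub>\<alpha> \<circ> s\<^sub>\<beta> \<circ> s\<^sub>\<alpha>) ` T) \<or>
        (y = s\<^sub>0 \<circ> s\<^sub>\<beta> \<circ> s\<^sub>0 \<circ> x \<and> x \<in> (\<circ>) s\<^sub>\<beta> ` T) \<or>
        (y = s\<^sub>\<alpha> \<circ> s\<^sub>0 \<circ> s\<^sub>\<alpha> \<circ> x \<and> x \<in> (\<circ>) s\<^sub>\<alpha> ` T)"
  proof (intro ballI)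
    fix x y assume "x \<in> W" "y \<in> W"
    then obtain m m' where m: "x = awg_map m" "y = awg_map m'" unfolding W by blast
    show "is_tw_interval \<alpha> \<beta> B 3 x y \<and> spherical \<alpha> \<beta> B x y \<longleftrightarrow>
        (y = s\<^sub>\<alpha> \<circ> s\<^sub>\<beta> \<circ> s\<^sub>\<alpha> \<circ> x \<and> x \<in> (\<circ>) (s\<^sub>\<alpha> \<circ> s\<^sub>\<beta> \<circ> s\<^sub>\<alpha>) ` T) \<or>
        (y = s\<^sub>0 \<circ> s\<^sub>\<beta> \<circ> s\<^sub>0 \<circ> x \<and> x \<in> (\<circ>) s\<^sub>\<beta> ` T) \<or>
        (y = s\<^sub>\<alpha> \<circ> s\<^sub>0 \<circ> s\<^sub>\<alpha> \<circ> x \<and> x \<in> (\<circ>) s\<^sub>\<alpha> ` T)"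
      unfolding B m length_3_intervals triple T_def
      unfolding s left_coset_transl_group awg_map_mult[symmetric] inj_eq[OF inj_awg_map]
      by (rule spherical_length_3_model)
  qed

  have ord: "\<forall>k>0. (u \<circ> v) ^^ k \<noteq> id"
    unfolding uv translation_power awg_map_one[symmetric] inj_eq[OF inj_awg_map] by simp

  have coset: "(\<circ>) (awg_map m) ` U = awg_map ` {m'. column m' = column m}" for m
    unfolding U by (rule coset_eq)
  have minimal: "\<forall>x\<in>W. \<forall>y\<in>(\<circ>) x ` U. unique_minimal \<alpha> \<beta> y ((\<circ>) x ` U) \<longleftrightarrow> (\<exists>i. y = inv_into UNIV (w i))"
  proof (intro ballI)
    fix x y assume "x \<in> W" and y: "y \<in> (\<circ>) x ` U"
    then obtain m where m: "x = awg_map m" unfolding W by blast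
    show "unique_minimal \<alpha> \<beta> y ((\<circ>) x ` U) \<longleftrightarrow> (\<exists>i. y = inv_into UNIV (w i))"
      using y unfolding m coset w by (rule unique_minimal_coset_iff)
  qed
  have decomp: "\<forall>x\<in>W. \<exists>z\<in>U. \<exists>i. x = inv_into UNIV (w i) \<circ> z"
  proof
    fix x assume "x \<in> W"
    then obtain m where m: "x = awg_map m" unfolding W by blast
    have "x \<in> (\<circ>) (awg_map (column_base (column m))) ` U"
      unfolding coset column_base m by simp
    then show "\<exists>z\<in>U. \<exists>i. x = inv_into UNIV (w i) \<circ> z"
      unfolding w by blast
  qed

  have powers: "(v \<circ> u) ^^ k = awg_map (W_1, - int k, - int k)" "(u \<circ> v) ^^ k = awg_map (W_1, int k, int k)"
    "u \<circ> (v \<circ> u) ^^ k = awg_map (W_aba, - int k, - int k)" "v \<circ> (u \<circ> v) ^^ k = awg_map (W_aba, 1 + int k, 1 + int k)" for k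
    unfolding uv translation_power unfolding u v awg_map_mult[symmetric] by simp_all
  \<comment> \<open>The base level is 0 for even \<open>i\<close> and -1 for odd \<open>i\<close>.
    By \<open>column_right_mult\<close> a translation adds 4n to it, and a factor with finite part
    \<open>W_aba\<close> turns c into 4n - 3 - c.\<close>
  have len:
    "l\<^sub>B (inv_into UNIV (w i) \<circ> u \<circ> (v \<circ> u) ^^ k) = (if even i then - 4 * int k - 3 else - 4 * int k - 2)"
    "l\<^sub>B (inv_into UNIV (w i) \<circ> (v \<circ> u) ^^ k) = (if even i then - 4 * int k else - 4 * int k - 1)"
    "l\<^sub>B (inv_into UNIV (w i) \<circ> v \<circ> (u \<circ> v) ^^ k) = (if even i then 4 * int k + 1 else 4 * int k + 2)"
    "l\<^sub>B (inv_into UNIV (w i) \<circ> (u \<circ> v) ^^ k) = (if even i then 4 * int k else 4 * int k - 1)" for i k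
    unfolding comp_assoc powers(3,4) unfolding powers(1,2) w awg_map_mult[symmetric] lB column_right_mult column_base by simp_all

  have auto: "\<forall>x\<in>W. \<forall>y\<in>W. (even (l\<^sub>B x) \<longleftrightarrow> even (l\<^sub>B y)) \<longrightarrow>
        (\<exists>\<phi>. bij_betw \<phi> W W \<and>
             (\<forall>a\<in>W. \<forall>b\<in>W. tw_le \<alpha> \<beta> B a b \<longleftrightarrow> tw_le \<alpha> \<beta> B (\<phi> a) (\<phi> b)) \<and>
             \<phi> x = y)"
    unfolding W B l\<^sub>B_def using tw_le_automorphism by blast

  show ?thesis
    unfolding simples
    apply (intro conjI)
    subgoal unfolding B by (intro allI impI) (rule length_2_intervals(1))
    subgoal unfolding B by (intro allI impI) (rule length_2_intervals(2))
    subgoal unfolding B by (intro allI impI) (rule length_2_intervals(3))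
    subgoal by (rule part_1b)
    subgoal unfolding B using not_spherical_length_gt_3 by blast
    subgoal by (rule prefix_x(1))
    subgoal by (rule prefix_y(1))
    subgoal by (rule unique(1))
    subgoal by (rule unique(2))
    subgoal by (rule uv(3))
    subgoal by (rule uv(4))
    subgoal by (rule ord)
    subgoal by (rule minimal)
    subgoal by (rule decomp)
    subgoal by (intro allI) (rule len(1))
    subgoal by (intro allI) (rule len(2))
    subgoal by (intro allI) (rule len(3))
    subgoal by (intro allI) (rule len(4))
    subgoal by (rule auto)
    done
qed

end
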